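(* Assume that $\varphi:\mathbb{T}\to\mathbb{R}_+$ is $2$-hyper-positive and is not identically zero. Then for any Hardy function $f\in H_0^2(\mathbb{T})$, the function $H_\varphi(f)$ is real-analytic and $$\left\|\frac{H_\varphi(f)}{\sqrt{\varphi}}\right\|_{L^\infty(\mathbb{T})}\le\|f\|_{L^2(\mathbb{T};\varphi)}:=\left(\int_{\mathbb{T}}|f(e^{it})|^2\varphi(e^{it})\,dm(t)\right)^{1/2}.$$
   Context: $\mathbb{N}=\{0,1,2,\dots\}$, $\mathbb{T}=\mathbb{R}/2\pi\mathbb{Z}$ with normalized Haar measure $m$; $\widehat{\varphi}(n)=\int_{\mathbb{T}}\varphi(e^{i\theta})e^{-in\theta}dm(\theta)$; functions on $\mathbb{T}$ are identified when equal almost everywhere. Let $\mathbb{F}_q^+$ be the unital free semigroup on generators $s_1,\dots,s_q$, with word length $|\cdot|$. A function $\alpha:\mathbb{N}\to\mathbb{C}$ is $q$-hyper-positive definite if the kernel $K$ on $\mathbb{F}_q^+$ given by $K(\sigma,\delta)=\alpha(|w|)$ if $\delta=\sigma w$ for some $w\in\mathbb{F}_q^+$, $K(\sigma,\delta)=\overline{\alpha(|w|)}$ if $\sigma=\delta w$ for some $w\in\mathbb{F}_q^+$, and $K(\sigma,\delta)=0$ otherwise, is positive definite (all matrices $[K(\sigma_i,\sigma_j)]_{i,j\le k}$ are non-negative definite). An integrable function $\varphi$ on $\mathbb{T}$ is $q$-hyper-positive if $\mathbb{N}\ni n\mapsto\widehat{\varphi}(n)$ is $q$-hyper-positive definite.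 $H^2(\mathbb{T})$ is the set of $f(e^{i\theta})=\sum_{n\ge0}a_ne^{in\theta}$ with $\sum|a_n|^2<\infty$; $H^2_0(\mathbb{T})=\{f\in H^2(\mathbb{T}):\widehat f(0)=0\}$; $H^2_-(\mathbb{T})=L^2(\mathbb{T})\ominus H_0^2(\mathbb{T})$ is the set of $\sum_{n\ge0}a_ne^{-in\theta}$ with $\sum|a_n|^2<\infty$. $R_-:L^2(\mathbb{T})\to H_-^2(\mathbb{T})$ is the orthogonal projection (keeping the Fourier modes $n\le0$). The Hankel operator is $H_\varphi(f)=R_-(\varphi f)$. *)

theory Defs
  imports
    "HOL-Analysis.Analysis"
    "HOL-Probability.Essential_Supremum"
    "HOL-Library.Sublist"
begin

section \<open>Functions on the circle\<close>

text \<open>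
  The circle is the unit sphere of the complex plane, with its normalized Haar measure. Functions
  on it are functions on the complex numbers whose values off the sphere are irrelevant.
  They are not quotiented by equality almost everywhere.
\<close>

definition circle :: "complex measure" where
  "circle = distr (uniform_measure lborel {0..<2 * pi}) (restrict_space borel (sphere 0 1)) cis"

definition fourier_coeff :: "(complex \<Rightarrow> complex) \<Rightarrow> int \<Rightarrow> complex" where
  "fourier_coeff \<phi> n = (LINT z|circle. \<phi> z * z powi (- n))"

definition L2 :: "(complex \<Rightarrow> complex) set" where
  "L2 = {f \<in> borel_measurable circle. integrable circle (\<lambda>z. (cmod (f z))\<^sup>2)}"

definition L2_norm :: "(complex \<Rightarrow> complex) \<Rightarrow> real" where
  "L2_norm f = sqrt (LINT z|circle. (cmod (f z))\<^sup>2)"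

definition L2_inner :: "(complex \<Rightarrow> complex) \<Rightarrow> (complex \<Rightarrow> complex) \<Rightarrow> complex" where
  "L2_inner f g = (LINT z|circle. f z * cnj (g z))"

definition weighted_L2_norm :: "(complex \<Rightarrow> real) \<Rightarrow> (complex \<Rightarrow> complex) \<Rightarrow> real" where
  "weighted_L2_norm \<phi> f = sqrt (LINT z|circle. (cmod (f z))\<^sup>2 * \<phi> z)"

definition Linf_norm :: "(complex \<Rightarrow> complex) \<Rightarrow> ereal" where
  "Linf_norm f = esssup circle (\<lambda>z. ereal (cmod (f z)))"

definition real_analytic_on_circle :: "(complex \<Rightarrow> complex) \<Rightarrow> bool" where
  "real_analytic_on_circle g \<longleftrightarrow>
     (\<forall>t\<^sub>0::real. \<exists>r>0. \<exists>a::nat \<Rightarrow> complex. \<forall>t::real. \<bar>t - t\<^sub>0\<bar> < r \<longrightarrow>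
        (\<lambda>n. a n * of_real ((t - t\<^sub>0) ^ n)) sums g (cis t))"

text \<open>Real-analyticity of an almost-everywhere class: some representative is real-analytic.\<close>

definition AE_real_analytic :: "(complex \<Rightarrow> complex) \<Rightarrow> bool" where
  "AE_real_analytic g \<longleftrightarrow>
     (\<exists>h. real_analytic_on_circle h \<and> (AE z in circle. g z = h z))"

section \<open>Hyper-positive functions\<close>

definition positive_definite_kernel :: "'a set \<Rightarrow> ('a \<Rightarrow> 'a \<Rightarrow> complex) \<Rightarrow> bool" where
  "positive_definite_kernel S K \<longleftrightarrow>
     (\<forall>(k::nat) s c. (\<forall>i<k. s i \<in> S) \<longrightarrow>
        (\<Sum>i<k. \<Sum>j<k. cnj (c i) * K (s i) (s j) * c j) \<in> nonneg_Reals)"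

text \<open>
  The free unital semigroup on \<open>q\<close> generators is the set of words over the letters
  \<open>0, \<dots>, q - 1\<close>. If \<open>\<delta> = \<sigma> @ w\<close> then the length of \<open>w\<close> is \<open>length \<delta> - length \<sigma>\<close>.
  For \<open>\<sigma> = \<delta>\<close> the two nonzero clauses of the kernel overlap; positivity on one-point sets makes
  \<open>\<alpha> 0\<close> real, so that they agree.
\<close>

definition free_semigroup :: "nat \<Rightarrow> nat list set" where
  "free_semigroup q = lists {..<q}"

definition hyper_kernel :: "(nat \<Rightarrow> complex) \<Rightarrow> nat list \<Rightarrow> nat list \<Rightarrow> complex" where
  "hyper_kernel \<alpha> \<sigma> \<delta> =
     (if prefix \<sigma> \<delta> then \<alpha> (length \<delta> - length \<sigma>)
      else if prefix \<delta> \<sigma> then cnj (\<alpha> (length \<sigma> - length \<delta>))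
      else 0)"

definition hyper_positive_definite :: "nat \<Rightarrow> (nat \<Rightarrow> complex) \<Rightarrow> bool" where
  "hyper_positive_definite q \<alpha> \<longleftrightarrow>
     positive_definite_kernel (free_semigroup q) (hyper_kernel \<alpha>)"

definition hyper_positive :: "nat \<Rightarrow> (complex \<Rightarrow> complex) \<Rightarrow> bool" where
  "hyper_positive q \<phi> \<longleftrightarrow>
     integrable circle \<phi> \<and> hyper_positive_definite q (\<lambda>n. fourier_coeff \<phi> (int n))"

section \<open>Hardy spaces and Hankel operators\<close>

definition H2 :: "(complex \<Rightarrow> complex) set" where
  "H2 = {f \<in> L2. \<exists>a::nat \<Rightarrow> complex. summable (\<lambda>n. (cmod (a n))\<^sup>2) \<and>
           (\<lambda>N. L2_norm (\<lambda>z. f z - (\<Sum>n<N. a n * z ^ n))) \<longlonglongrightarrow> 0}"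

definition H2_0 :: "(complex \<Rightarrow> complex) set" where
  "H2_0 = {f \<in> H2. fourier_coeff f 0 = 0}"

definition H2_minus :: "(complex \<Rightarrow> complex) set" where
  "H2_minus = {g \<in> L2. \<forall>f\<in>H2_0. L2_inner g f = 0}"

text \<open>
  A representative of the orthogonal projection of \<open>g\<close> onto the subspace \<open>V\<close> of \<open>L2\<close>. It is
  meaningful for \<open>g \<in> L2\<close> and closed \<open>V\<close>, and is then determined up to equality almost everywhere.
\<close>

definition orth_proj :: "(complex \<Rightarrow> complex) set \<Rightarrow> (complex \<Rightarrow> complex) \<Rightarrow> complex \<Rightarrow> complex" where
  "orth_proj V g = (SOME h. h \<in> V \<and> (\<forall>k\<in>V. L2_inner (\<lambda>z. g z - h z) k = 0))"

definition R_minus :: "(complex \<Rightarrow> complex) \<Rightarrow> complex \<Rightarrow> complex" where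
  "R_minus = orth_proj H2_minus"

definition hankel :: "(complex \<Rightarrow> complex) \<Rightarrow> (complex \<Rightarrow> complex) \<Rightarrow> complex \<Rightarrow> complex" where
  "hankel \<phi> f = R_minus (\<lambda>z. \<phi> z * f z)"

end

theory Submission
  imports
    Defs
    "HOL-Probability.Probability_Measure"
    "HOL-Complex_Analysis.Cauchy_Integral_Formula"
begin

text \<open>
  Write \<open>c n\<close> for the Fourier coefficients of \<open>\<phi>\<close>, and realize the kernel of the free semigroup on
  two letters \<open>0, 1\<close> as the Gram matrix of vectors \<open>v w\<close> indexed by words. Words of which neither is a
  prefix of the other have orthogonal vectors, while the words along a single path have the Gram
  matrix of the monomials in \<open>L\<^sup>2(\<phi>)\<close>.

  Decay. The \<open>2\<^sup>n\<close> words of length \<open>n\<close> are pairwise orthogonal and all have the same inner product with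
  the empty word, up to conjugation \<open>c n\<close>. Bessel's inequality gives \<open>2\<^sup>n |c n|\<^sup>2 \<le> (c 0)\<^sup>2\<close>. Hence \<open>\<phi>\<close>
  agrees almost everywhere with the sum of its Fourier series (\<open>AE_zero_if_fourier_coeff_zero\<close>), which
  is continuous, and the coefficients \<open>h l = (\<Sum>k. a k * c (- l - k))\<close> of \<open>H\<^sub>\<phi> f\<close>, for
  \<open>f = (\<Sum>k. a k * z ^ k)\<close> with \<open>k \<ge> 1\<close>, decay geometrically. This makes \<open>H\<^sub>\<phi> f\<close> real-analytic
  (\<open>real_analytic_trig_series\<close>).

  The bound. Take the words \<open>0\<^sup>i\<close>, \<open>i < N\<close>, as a stem, and at each of its nodes \<open>0\<^sup>j\<close> let a branch
  \<open>0\<^sup>j 1\<^sup>k\<close>, \<open>k \<ge> 1\<close>, leave it. Put a copy \<open>u j\<close> of \<open>f\<close> (with conjugated coefficients) on the branch at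
  \<open>0\<^sup>j\<close>. Different branches are orthogonal, and each \<open>u j\<close> has squared norm \<open>A\<close>, the squared norm of \<open>f\<close>
  in \<open>L\<^sup>2(\<phi>)\<close>. For \<open>|z| = 1\<close> let \<open>y\<close> be the vector on the stem with weights \<open>z ^ i\<close>. Only the stem
  words \<open>0\<^sup>i\<close> with \<open>i \<le> j\<close> are comparable with the branch at \<open>0\<^sup>j\<close>, so the inner product of \<open>u j\<close> and
  \<open>y\<close> has the absolute value of the partial sum \<open>S j = (\<Sum>l\<le>j. h l * cnj z ^ l)\<close> of \<open>H\<^sub>\<phi> f\<close> at \<open>z\<close>. The
  squared norm of \<open>y\<close> is \<open>(\<Sum>j<N. D j)\<close>, where \<open>D j\<close> is the symmetric partial sum of the Fourier series
  of \<open>\<phi>\<close> at \<open>z\<close>. Bessel's inequality therefore says \<open>(\<Sum>j<N. |S j|\<^sup>2) \<le> A * (\<Sum>j<N. D j)\<close>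
  (\<open>hyper_positive_definite_Bessel\<close>). Dividing by \<open>N\<close> and letting \<open>N\<close> tend to infinity turns this into
  \<open>|H\<^sub>\<phi> f z|\<^sup>2 \<le> A * \<phi> z\<close> at every point of the circle, with the continuous representative of \<open>\<phi>\<close>, for
  polynomials \<open>f\<close> first (\<open>hankel_poly_bound\<close>) and by approximation for all \<open>f\<close> (\<open>hankel_series\<close>).

  Since \<open>R_minus\<close> is given by a choice operator, \<open>H\<^sub>\<phi> f\<close> is identified by exhibiting the series with
  coefficients \<open>h\<close>: it lies in \<open>H2_minus\<close> and differs from \<open>\<phi> f\<close> by a function orthogonal to \<open>H2_minus\<close>
  (\<open>R_minus_unique\<close>).
\<close>

section \<open>Bessel's inequality for positive-definite kernels\<close>

text \<open>
  Positivity for families over an arbitrary finite index set, so that several families of vectors can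
  be combined by a sum type without enumerating them.
\<close>

lemma positive_definite_kernel_finite_sum:
  fixes s :: "'i \<Rightarrow> 'a" and c :: "'i \<Rightarrow> complex"
  assumes "positive_definite_kernel S K" "finite I" "\<And>i. i \<in> I \<Longrightarrow> s i \<in> S"
  shows "0 \<le> Re (\<Sum>i\<in>I. \<Sum>j\<in>I. cnj (c i) * K (s i) (s j) * c j)"
proof -
  obtain e :: "nat \<Rightarrow> 'i" where e: "bij_betw e {..<card I} I"
    using ex_bij_betw_nat_finite[OF assms(2)] by (auto simp: atLeast0LessThan)
  have "\<forall>i<card I. (s \<circ> e) i \<in> S"
    using e assms(3) by (auto simp: bij_betw_def)
  then have "(\<Sum>i<card I. \<Sum>j<card I. cnj ((c \<circ> e) i) * K ((s \<circ> e) i) ((s \<circ> e) j) * (c \<circ> e) j)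
      \<in> nonneg_Reals"
    using assms(1) unfolding positive_definite_kernel_def by blast
  also have "(\<Sum>i<card I. \<Sum>j<card I. cnj ((c \<circ> e) i) * K ((s \<circ> e) i) ((s \<circ> e) j) * (c \<circ> e) j)
      = (\<Sum>i<card I. \<Sum>j\<in>I. cnj (c (e i)) * K (s (e i)) (s j) * c j)"
    by (intro sum.cong refl) (simp add: sum.reindex_bij_betw[OF e, symmetric])
  also have "\<dots> = (\<Sum>i\<in>I. \<Sum>j\<in>I. cnj (c i) * K (s i) (s j) * c j)"
    by (rule sum.reindex_bij_betw[OF e, of "\<lambda>i. \<Sum>j\<in>I. cnj (c i) * K (s i) (s j) * c j"])
  finally show ?thesis by (simp only: complex_nonneg_Reals_iff)
qed

text \<open>
  Think of \<open>K u v\<close> as the inner product of vectors attached to \<open>u\<close> and \<open>v\<close>. The combinations with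
  coefficients \<open>a\<close> over \<open>t j q\<close>, \<open>q \<in> Q\<close>, form for varying \<open>j\<close> an orthogonal system of vectors of
  squared norm \<open>A\<close>, and the combination with coefficients \<open>b\<close> over \<open>p i\<close> is a vector of squared norm
  \<open>B\<close>; this is Bessel's inequality for them. Only positivity of the kernel is available, so it is
  applied to \<open>x\<close> times the second vector minus its projections onto the first ones (up to the factor
  \<open>A\<close>), and the real number \<open>x\<close> is then optimized.
\<close>

lemma positive_definite_kernel_Bessel:
  fixes K :: "'a \<Rightarrow> 'a \<Rightarrow> complex" and p :: "'p \<Rightarrow> 'a" and t :: "'j \<Rightarrow> 'q \<Rightarrow> 'a"
  assumes pd: "positive_definite_kernel S K"
    and herm: "\<And>u v. u \<in> S \<Longrightarrow> v \<in> S \<Longrightarrow> K v u = cnj (K u v)"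
    and fin: "finite P" "finite J" "finite Q" and ne: "J \<noteq> {}"
    and S: "\<And>i. i \<in> P \<Longrightarrow> p i \<in> S" "\<And>j q. j \<in> J \<Longrightarrow> q \<in> Q \<Longrightarrow> t j q \<in> S"
    and orth: "\<And>i j q q'. \<lbrakk>i \<in> J; j \<in> J; i \<noteq> j; q \<in> Q; q' \<in> Q\<rbrakk> \<Longrightarrow> K (t i q) (t j q') = 0"
    and A: "\<And>j. j \<in> J \<Longrightarrow> (\<Sum>q\<in>Q. \<Sum>q'\<in>Q. cnj (a q) * K (t j q) (t j q') * a q') = A"
    and B: "(\<Sum>i\<in>P. \<Sum>i'\<in>P. cnj (b i) * K (p i) (p i') * b i') = B"
  shows "(\<Sum>j\<in>J. (cmod (\<Sum>q\<in>Q. \<Sum>i\<in>P. cnj (a q) * K (t j q) (p i) * b i))\<^sup>2) \<le> Re A * Re B"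
proof -
  define g where "g j = (\<Sum>q\<in>Q. \<Sum>i\<in>P. cnj (a q) * K (t j q) (p i) * b i)" for j
  define G where "G = (\<Sum>j\<in>J. (cmod (g j))\<^sup>2)"
  have gg: "cnj (g j) * g j = of_real ((cmod (g j))\<^sup>2)" for j
    by (metis complex_norm_square mult.commute)
  have quad: "0 \<le> x\<^sup>2 * Re B - 2 * x * G + Re A * G" for x :: real
  proof -
    let ?I = "P <+> (J \<times> Q)"
    define s where "s u = (case u of Inl i \<Rightarrow> p i | Inr (j, q) \<Rightarrow> t j q)" for u
    \<comment> \<open>The coefficients of \<open>x * y - (\<Sum>j. g j * u j)\<close>, where \<open>y\<close> has coefficients \<open>b\<close>, \<open>u j\<close> has coefficients \<open>a\<close> and \<open>g j\<close> is their inner product.\<close>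
    define c where "c u = (case u of Inl i \<Rightarrow> of_real x * b i | Inr (j, q) \<Rightarrow> - (g j * a q))" for u
    have 1: "(\<Sum>i\<in>P. \<Sum>i'\<in>P. cnj (c (Inl i)) * K (p i) (p i') * c (Inl i')) = of_real (x\<^sup>2) * B"
      unfolding B[symmetric] c_def sum_distrib_left
      by (intro sum.cong refl) (simp add: power2_eq_square)
    have 2: "(\<Sum>(j,q)\<in>J \<times> Q. \<Sum>i\<in>P. cnj (c (Inr (j,q))) * K (t j q) (p i) * c (Inl i)) = - of_real (x * G)"
    proof -
      have "(\<Sum>(j,q)\<in>J \<times> Q. \<Sum>i\<in>P. cnj (c (Inr (j,q))) * K (t j q) (p i) * c (Inl i)) =
        (\<Sum>j\<in>J. \<Sum>q\<in>Q. \<Sum>i\<in>P. - (of_real x * cnj (g j) * (cnj (a q) * K (t j q) (p i) * b i)))"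
        by (simp add: sum.cartesian_product[symmetric] c_def mult_ac)
      also have "\<dots> = (\<Sum>j\<in>J. - (of_real x * cnj (g j) * g j))"
        unfolding g_def by (simp add: sum_negf sum_distrib_left)
      also have "\<dots> = - of_real (x * G)"
        by (simp add: G_def gg mult.assoc sum_negf sum_distrib_left)
      finally show ?thesis .
    qed
    have 3: "(\<Sum>i\<in>P. \<Sum>(j,q)\<in>J \<times> Q. cnj (c (Inl i)) * K (p i) (t j q) * c (Inr (j,q))) = - of_real (x * G)"
    proof -
      have "(\<Sum>i\<in>P. \<Sum>(j,q)\<in>J \<times> Q. cnj (c (Inl i)) * K (p i) (t j q) * c (Inr (j,q)))
        = (\<Sum>(j,q)\<in>J \<times> Q. \<Sum>i\<in>P. cnj (c (Inl i)) * K (p i) (t j q) * c (Inr (j,q)))"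
        by (subst sum.swap) (auto intro!: sum.cong)
      also have "\<dots> = cnj (\<Sum>(j,q)\<in>J \<times> Q. \<Sum>i\<in>P. cnj (c (Inr (j,q))) * K (t j q) (p i) * c (Inl i))"
        unfolding cnj_sum
        by (intro sum.cong refl) (auto simp: herm[OF S(2) S(1)] mult_ac intro!: sum.cong)
      finally show ?thesis unfolding 2 by simp
    qed
    have 4: "(\<Sum>(j,q)\<in>J \<times> Q. \<Sum>(j',q')\<in>J \<times> Q. cnj (c (Inr (j,q))) * K (t j q) (t j' q') * c (Inr (j',q')))
      = A * of_real G"
    proof -
      have "(\<Sum>(j,q)\<in>J \<times> Q. \<Sum>(j',q')\<in>J \<times> Q. cnj (c (Inr (j,q))) * K (t j q) (t j' q') * c (Inr (j',q')))
        = (\<Sum>j\<in>J. \<Sum>q\<in>Q. \<Sum>j'\<in>J. \<Sum>q'\<in>Q. cnj (g j * a q) * K (t j q) (t j' q') * (g j' * a q'))"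
        by (simp add: sum.cartesian_product[symmetric] c_def)
      also have "\<dots> = (\<Sum>j\<in>J. \<Sum>q\<in>Q. \<Sum>j'\<in>J. if j' = j then
          (\<Sum>q'\<in>Q. cnj (g j * a q) * K (t j q) (t j q') * (g j * a q')) else 0)"
        by (intro sum.cong refl) (auto simp: orth intro!: sum.neutral)
      also have "\<dots> = (\<Sum>j\<in>J. \<Sum>q\<in>Q. \<Sum>q'\<in>Q. cnj (g j * a q) * K (t j q) (t j q') * (g j * a q'))"
        using fin by simp
      also have "\<dots> = (\<Sum>j\<in>J. cnj (g j) * g j * (\<Sum>q\<in>Q. \<Sum>q'\<in>Q. cnj (a q) * K (t j q) (t j q') * a q'))"
        unfolding sum_distrib_left by (intro sum.cong refl) (simp add: mult_ac)
      also have "\<dots> = (\<Sum>j\<in>J. of_real ((cmod (g j))\<^sup>2) * A)"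
        by (intro sum.cong refl) (simp only: A gg)
      finally show ?thesis by (simp add: G_def sum_distrib_left sum_distrib_right mult_ac)
    qed
    have "0 \<le> Re (\<Sum>u\<in>?I. \<Sum>v\<in>?I. cnj (c u) * K (s u) (s v) * c v)"
      by (rule positive_definite_kernel_finite_sum[OF pd]) (use fin S in \<open>auto simp: s_def\<close>)
    also have "(\<Sum>u\<in>?I. \<Sum>v\<in>?I. cnj (c u) * K (s u) (s v) * c v) =
       (\<Sum>i\<in>P. \<Sum>i'\<in>P. cnj (c (Inl i)) * K (p i) (p i') * c (Inl i')) +
       (\<Sum>i\<in>P. \<Sum>(j,q)\<in>J \<times> Q. cnj (c (Inl i)) * K (p i) (t j q) * c (Inr (j,q))) +
       (\<Sum>(j,q)\<in>J \<times> Q. \<Sum>i\<in>P. cnj (c (Inr (j,q))) * K (t j q) (p i) * c (Inl i)) +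
       (\<Sum>(j,q)\<in>J \<times> Q. \<Sum>(j',q')\<in>J \<times> Q. cnj (c (Inr (j,q))) * K (t j q) (t j' q') * c (Inr (j',q')))"
      using fin
      by (simp add: sum.Plus sum.distrib s_def case_prod_unfold)
    also have "Re \<dots> = x\<^sup>2 * Re B - 2 * x * G + Re A * G"
      unfolding 1 2 3 4 by simp
    finally show ?thesis .
  qed
  have A0: "0 \<le> Re A"
  proof -
    obtain j where "j \<in> J" using ne by blast
    then show ?thesis
      using positive_definite_kernel_finite_sum[OF pd fin(3), of "t j" a] S(2) A by simp
  qed
  have B0: "0 \<le> Re B"
    using positive_definite_kernel_finite_sum[OF pd fin(1), of p b] S(1) B by simp
  have G0: "0 \<le> G" by (simp add: G_def sum_nonneg)
  have "G \<le> Re A * Re B"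
  proof (cases "Re B = 0")
    case True
    \<comment> \<open>This \<open>x\<close> turns the right-hand side of \<open>quad\<close> into \<open>- 2 * G\<close>.\<close>
    have "G \<le> 0" using quad[of "Re A / 2 + 1"] True by (simp add: distrib_right)
    then show ?thesis using True by simp
  next
    case False
    then have B1: "0 < Re B" using B0 by simp
    have "0 \<le> (G / Re B)\<^sup>2 * Re B - 2 * (G / Re B) * G + Re A * G" by (rule quad)
    also have "\<dots> = G * (Re A - G / Re B)"
      using B1 by (simp add: field_simps power2_eq_square)
    finally have "G = 0 \<or> 0 \<le> Re A - G / Re B"
      using G0 by (auto simp: zero_le_mult_iff)
    then show ?thesis using B1 A0 by (auto simp: field_simps)
  qed
  then show ?thesis by (simp add: G_def g_def)
qed

section \<open>Hyper-positive definite sequences\<close>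

lemma hyper_kernel_eq:
  fixes c :: "int \<Rightarrow> complex"
  assumes herm: "\<And>n. c (- n) = cnj (c n)"
  shows "hyper_kernel (\<lambda>n. c (int n)) \<sigma> \<delta> =
    (if prefix \<sigma> \<delta> \<or> prefix \<delta> \<sigma> then c (int (length \<delta>) - int (length \<sigma>)) else 0)"
proof -
  have "cnj (c (int (length \<sigma>) - int (length \<delta>))) = c (int (length \<delta>) - int (length \<sigma>))"
    using herm[of "int (length \<sigma>) - int (length \<delta>)"] by (simp only: minus_diff_eq)
  then show ?thesis
    by (cases "prefix \<sigma> \<delta>") (simp_all add: hyper_kernel_def of_nat_diff prefix_length_le)
qed

lemma hyper_kernel_hermitian:
  fixes c :: "int \<Rightarrow> complex"
  assumes herm: "\<And>n. c (- n) = cnj (c n)"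
  shows "hyper_kernel (\<lambda>n. c (int n)) \<delta> \<sigma> = cnj (hyper_kernel (\<lambda>n. c (int n)) \<sigma> \<delta>)"
proof -
  have "c (int (length \<sigma>) - int (length \<delta>)) = cnj (c (int (length \<delta>) - int (length \<sigma>)))"
    using herm[of "int (length \<delta>) - int (length \<sigma>)"] by (simp only: minus_diff_eq)
  then show ?thesis
    unfolding hyper_kernel_eq[of c, OF herm] by auto
qed

text \<open>
  All words of length \<open>n\<close> are pairwise orthogonal, and there are \<open>q ^ n\<close> of them, each with inner product
  of absolute value \<open>|c n|\<close> with the empty word.
\<close>

lemma hyper_positive_definite_decay:
  fixes c :: "int \<Rightarrow> complex"
  assumes herm: "\<And>n. c (- n) = cnj (c n)"
    and pd: "hyper_positive_definite q (\<lambda>n. c (int n))" and q: "0 < q"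
  shows "real q ^ n * (cmod (c (int n)))\<^sup>2 \<le> (Re (c 0))\<^sup>2"
proof -
  let ?K = "hyper_kernel (\<lambda>n. c (int n))"
  let ?J = "{w. set w \<subseteq> {..<q} \<and> length w = n}"
  have ne: "replicate n 0 \<in> ?J" using q by (auto simp: set_replicate_conv_if)
  have "(\<Sum>w\<in>?J. (cmod (\<Sum>q\<in>{()}. \<Sum>i\<in>{()}. cnj 1 * hyper_kernel (\<lambda>n. c (int n)) w [] * 1))\<^sup>2)
     \<le> Re (c 0) * Re (c 0)"
  proof (rule positive_definite_kernel_Bessel[where K = ?K and S = "free_semigroup q" and t = "\<lambda>w q. w" and p = "\<lambda>i. []"
        and a = "\<lambda>_. 1" and b = "\<lambda>_. 1" and A = "c 0" and B = "c 0"])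
    show "positive_definite_kernel (free_semigroup q) (hyper_kernel (\<lambda>n. c (int n)))"
      using pd by (simp add: hyper_positive_definite_def)
    show "finite ?J" by (rule finite_lists_length_eq) simp
    show "?J \<noteq> {}" using ne by blast
    show "?K v u = cnj (?K u v)" for u v
      by (rule hyper_kernel_hermitian[of c, OF herm])
    show "?K u v = 0" if "u \<in> ?J" "v \<in> ?J" "u \<noteq> v" for u v
    proof -
      have "length u = length v" using that by simp
      then have "\<not> prefix u v" "\<not> prefix v u"
        using \<open>u \<noteq> v\<close> by (simp_all add: prefix_def) (metis append_Nil2 length_append add_cancel_right_right length_0_conv)+
      then show ?thesis by (simp add: hyper_kernel_eq[of c, OF herm])
    qed
    show "(\<Sum>q\<in>{()}. \<Sum>q'\<in>{()}. cnj 1 * ?K w w * 1) = c 0" for w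
      by (simp add: hyper_kernel_eq[of c, OF herm])
  qed (auto simp: free_semigroup_def hyper_kernel_eq[of c, OF herm])
  also have "(\<Sum>w\<in>?J. (cmod (\<Sum>q\<in>{()}. \<Sum>i\<in>{()}. cnj 1 * hyper_kernel (\<lambda>n. c (int n)) w [] * 1))\<^sup>2)
     = (\<Sum>w\<in>?J. (cmod (c (int n)))\<^sup>2)"
    by (intro sum.cong refl) (simp add: hyper_kernel_eq[of c, OF herm] herm)
  also have "\<dots> = real q ^ n * (cmod (c (int n)))\<^sup>2"
    by (simp add: card_lists_length_eq)
  finally show ?thesis by (simp add: power2_eq_square)
qed

text \<open>
  Passing from \<open>N\<close> to \<open>N + 1\<close> adds one row and one column to the Toeplitz form, which contribute \<open>c 0\<close>
  and two conjugate halves of a symmetric partial sum of the Fourier series. Up to the factor \<open>N\<close> this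
  is the Fejer mean at \<open>z\<close>.
\<close>

lemma Re_toeplitz_sum:
  fixes c :: "int \<Rightarrow> complex"
  assumes herm: "\<And>n. c (- n) = cnj (c n)" and z: "cmod z = 1"
  shows "Re (\<Sum>i<N. \<Sum>i'<N. cnj (z ^ i) * c (int i' - int i) * z ^ i')
    = (\<Sum>j<N. Re (c 0) + 2 * Re (\<Sum>d=1..j. c (int d) * z ^ d))"
proof (induction N)
  case (Suc N)
  have zz: "cnj z ^ n * z ^ n = 1" for n
    using z by (simp add: power_mult_distrib[symmetric] mult.commute[of "cnj z"] complex_norm_square[symmetric])
  define T where "T = (\<Sum>d=1..N. c (int d) * z ^ d)"
  have T: "(\<Sum>i<N. cnj (z ^ i) * c (int N - int i) * z ^ N) = T"
    unfolding T_def
  proof (rule sum.reindex_bij_witness[of _ "\<lambda>d. N - d" "\<lambda>i. N - i"])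
    fix i assume "i \<in> {..<N}"
    then have "i \<le> N" by simp
    then have "z ^ N = z ^ i * z ^ (N - i)" by (simp add: power_add[symmetric])
    then have "cnj (z ^ i) * c (int N - int i) * z ^ N
        = (cnj z ^ i * z ^ i) * (c (int (N - i)) * z ^ (N - i))"
      using \<open>i \<le> N\<close> by (simp add: of_nat_diff mult_ac)
    then show "c (int (N - i)) * z ^ (N - i) = cnj (z ^ i) * c (int N - int i) * z ^ N"
      by (simp only: zz mult_1)
  qed auto
  have T': "(\<Sum>i<N. cnj (z ^ N) * c (int i - int N) * z ^ i) = cnj T"
    unfolding T[symmetric] cnj_sum
    by (intro sum.cong refl) (simp add: herm[symmetric] mult_ac)
  have diag: "cnj z ^ N * c 0 * z ^ N = c 0"
    using zz[of N] by (simp add: mult.commute mult.left_commute)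
  have "(\<Sum>i<Suc N. \<Sum>i'<Suc N. cnj (z ^ i) * c (int i' - int i) * z ^ i') =
     (\<Sum>i<N. \<Sum>i'<N. cnj (z ^ i) * c (int i' - int i) * z ^ i') + T + cnj T + c 0"
    using diag by (simp add: sum.distrib T[unfolded complex_cnj_power] T'[unfolded complex_cnj_power])
  then have "Re (\<Sum>i<Suc N. \<Sum>i'<Suc N. cnj (z ^ i) * c (int i' - int i) * z ^ i') =
     Re (\<Sum>i<N. \<Sum>i'<N. cnj (z ^ i) * c (int i' - int i) * z ^ i') + (Re (c 0) + 2 * Re T)"
    by (simp only: plus_complex.sel cnj.simps)
  then show ?case unfolding Suc.IH by (simp only: T_def sum.lessThan_Suc)
qed simp

text \<open>
  The heart of the matter. Bessel's inequality is applied to a vector on the stem of words \<open>0\<^sup>i\<close> with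
  weights \<open>z ^ i\<close> and to copies of one polynomial on the branches \<open>0\<^sup>j 1\<^sup>k\<close>. A second letter is what makes
  copies at different nodes orthogonal. The branch at \<open>0\<^sup>j\<close> is comparable only with stem words \<open>0\<^sup>i\<close>,
  \<open>i \<le> j\<close>, which is why truncated sums over \<open>l \<le> j\<close> appear.
\<close>

lemma hyper_positive_definite_Bessel:
  fixes c :: "int \<Rightarrow> complex" and a :: "nat \<Rightarrow> complex"
  assumes herm: "\<And>n. c (- n) = cnj (c n)"
    and pd: "hyper_positive_definite 2 (\<lambda>n. c (int n))"
    and z: "cmod z = 1" and Q: "finite Q" "0 \<notin> Q"
  defines "h \<equiv> (\<lambda>l. \<Sum>k\<in>Q. a k * c (- int (l + k)))"
  shows "(\<Sum>j<N. (cmod (\<Sum>l\<le>j. h l * cnj z ^ l))\<^sup>2) \<le>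
    Re (\<Sum>k\<in>Q. \<Sum>k'\<in>Q. a k * c (int k' - int k) * cnj (a k')) *
    (\<Sum>j<N. Re (c 0) + 2 * Re (\<Sum>d=1..j. c (int d) * z ^ d))"
proof (cases "N = 0")
  case False
  let ?K = "hyper_kernel (\<lambda>n. c (int n))"
  let ?p = "\<lambda>i. replicate i (0::nat)"
  let ?t = "\<lambda>j k. replicate j (0::nat) @ replicate k 1"
  have branch: "prefix (?p i) (?t j k) \<longleftrightarrow> i \<le> j" "\<not> prefix (?t j k) (?p i)" if "k \<in> Q" for i j k
  proof -
    have k: "0 < k" using that Q by (cases k) auto
    have "i \<le> j" if "prefix (?p i) (?t j k)"
    proof (rule ccontr)
      assume "\<not> i \<le> j"
      then have "?p i ! j = ?t j k ! j"
        using that by (metis length_replicate not_le_imp_less nth_append prefix_def)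
      then show False using k \<open>\<not> i \<le> j\<close> by (simp add: nth_append)
    qed
    moreover have "prefix (?p i) (?t j k)" if "i \<le> j"
      using that by (metis append.assoc le_add_diff_inverse prefixI replicate_add)
    ultimately show "prefix (?p i) (?t j k) \<longleftrightarrow> i \<le> j" by blast
    show "\<not> prefix (?t j k) (?p i)"
    proof
      assume "prefix (?t j k) (?p i)"
      then have "set (?t j k) \<subseteq> set (?p i)" by (rule set_mono_prefix)
      then show False using k by auto
    qed
  qed
  have stem_branch: "?K (?t j k) (?p i) = (if i \<le> j then c (- int (j - i + k)) else 0)" if "k \<in> Q" for i j k
    using branch[OF that] by (auto simp: hyper_kernel_eq[of c, OF herm] of_nat_diff algebra_simps)
  have orth: "\<not> prefix (?t i k) (?t j k')" if "k \<in> Q" "k' \<in> Q" "i \<noteq> j" for i j k k'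
  proof
    assume pre: "prefix (?t i k) (?t j k')"
    have "prefix (?p i) (?t j k')" using pre by (metis append_prefixD)
    then have "i < j" using branch(1)[OF that(2)] that(3) by simp
    then obtain r where r: "j = i + Suc r" using less_iff_Suc_add by auto
    have "k \<noteq> 0" "k' \<noteq> 0" using that Q by metis+
    then obtain m m' where "k = Suc m" "k' = Suc m'" using not0_implies_Suc by blast
    then show False using pre unfolding r replicate_add by simp
  qed
  have line: "?K (?t j k) (?t j k') = c (int k' - int k)" for j k k'
  proof -
    have "prefix (?t j k) (?t j k') \<or> prefix (?t j k') (?t j k)"
      by (simp, metis le_add_diff_inverse nle_le prefixI replicate_add)
    then show ?thesis by (auto simp: hyper_kernel_eq[of c, OF herm])
  qed
  have "(\<Sum>j<N. (cmod (\<Sum>k\<in>Q. \<Sum>i<N. cnj (cnj (a k)) * ?K (?t j k) (?p i) * z ^ i))\<^sup>2) \<le>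
    Re (\<Sum>k\<in>Q. \<Sum>k'\<in>Q. a k * c (int k' - int k) * cnj (a k')) *
    Re (\<Sum>i<N. \<Sum>i'<N. cnj (z ^ i) * c (int i' - int i) * z ^ i')"
  proof (rule positive_definite_kernel_Bessel[where t = ?t and p = ?p])
    show "positive_definite_kernel (free_semigroup 2) ?K"
      using pd by (simp add: hyper_positive_definite_def)
    show "?K v u = cnj (?K u v)" for u v
      by (rule hyper_kernel_hermitian[of c, OF herm])
    show "?K (?t i k) (?t j k') = 0" if "i \<noteq> j" "k \<in> Q" "k' \<in> Q" for i j k k'
      using orth[of k k' i j] orth[of k' k j i] that by (auto simp: hyper_kernel_eq[of c, OF herm])
    show "(\<Sum>i<N. \<Sum>i'<N. cnj (z ^ i) * ?K (?p i) (?p i') * z ^ i') =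
      (\<Sum>i<N. \<Sum>i'<N. cnj (z ^ i) * c (int i' - int i) * z ^ i')"
    proof (intro sum.cong refl)
      fix i i'
      have "prefix (?p i) (?p i') \<or> prefix (?p i') (?p i)"
        by (metis le_add_diff_inverse nle_le prefixI replicate_add)
      then show "cnj (z ^ i) * ?K (?p i) (?p i') * z ^ i' = cnj (z ^ i) * c (int i' - int i) * z ^ i'"
        by (auto simp: hyper_kernel_eq[of c, OF herm])
    qed
  qed (use False Q line in \<open>auto simp: free_semigroup_def\<close>)
  also have "(\<Sum>j<N. (cmod (\<Sum>k\<in>Q. \<Sum>i<N. cnj (cnj (a k)) * ?K (?t j k) (?p i) * z ^ i))\<^sup>2) =
    (\<Sum>j<N. (cmod (\<Sum>l\<le>j. h l * cnj z ^ l))\<^sup>2)"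
  proof (rule sum.cong[OF refl])
    fix j assume j: "j \<in> {..<N}"
    have "(\<Sum>k\<in>Q. \<Sum>i<N. cnj (cnj (a k)) * ?K (?t j k) (?p i) * z ^ i) =
       (\<Sum>k\<in>Q. \<Sum>i<N. if i \<le> j then a k * c (- int (j - i + k)) * z ^ i else 0)"
      by (intro sum.cong refl) (subst stem_branch, assumption, simp)
    also have "\<dots> = (\<Sum>k\<in>Q. \<Sum>i\<le>j. a k * c (- int (j - i + k)) * z ^ i)"
      using j by (intro sum.cong refl sum.mono_neutral_cong_right) auto
    also have "\<dots> = (\<Sum>i\<le>j. h (j - i) * z ^ i)"
      unfolding h_def sum_distrib_right by (rule sum.swap)
    also have "\<dots> = (\<Sum>l\<le>j. h l * z ^ (j - l))"
      by (rule sum.reindex_bij_witness[of _ "\<lambda>l. j - l" "\<lambda>l. j - l"]) auto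
    also have "\<dots> = z ^ j * (\<Sum>l\<le>j. h l * cnj z ^ l)"
      unfolding sum_distrib_left
    proof (intro sum.cong refl)
      fix l assume "l \<in> {..j}"
      then have "z ^ j = z ^ (j - l) * z ^ l" by (simp add: power_add[symmetric])
      then have "z ^ j * (h l * cnj z ^ l) = (z * cnj z) ^ l * (h l * z ^ (j - l))"
        by (simp add: power_mult_distrib mult_ac)
      also have "\<dots> = h l * z ^ (j - l)" using z by (simp add: complex_norm_square[symmetric])
      finally show "h l * z ^ (j - l) = z ^ j * (h l * cnj z ^ l)" ..
    qed
    finally show "(cmod (\<Sum>k\<in>Q. \<Sum>i<N. cnj (cnj (a k)) * ?K (?t j k) (?p i) * z ^ i))\<^sup>2 =
      (cmod (\<Sum>l\<le>j. h l * cnj z ^ l))\<^sup>2"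
      using z by (simp add: norm_mult norm_power)
  qed
  finally show ?thesis unfolding Re_toeplitz_sum[of c, OF herm z] .
qed simp

section \<open>Fourier coefficients on the circle\<close>

lemma space_circle [simp]: "space circle = sphere 0 1"
  by (simp add: circle_def space_restrict_space)

lemma sets_circle [measurable_cong]: "sets circle = sets (restrict_space borel (sphere 0 1))"
  by (simp add: circle_def)

lemma cis_measurable_circle [measurable]:
  "cis \<in> uniform_measure lborel {0..<2 * pi} \<rightarrow>\<^sub>M restrict_space borel (sphere 0 1)"
proof -
  have "cis \<in> borel_measurable borel"
    by (intro borel_measurable_continuous_onI continuous_intros)
  then show ?thesis
    by (intro measurable_restrict_space2) (auto simp: measurable_def)
qed

interpretation circle: prob_space circle
  unfolding circle_def
  by (intro prob_space.prob_space_distr prob_space_uniform_measure) auto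

lemma borel_measurable_circle_continuous:
  fixes f :: "complex \<Rightarrow> 'b::topological_space"
  assumes "continuous_on (sphere 0 1) f"
  shows "f \<in> borel_measurable circle"
  using borel_measurable_continuous_on_restrict[OF assms]
  by (simp cong: measurable_cong_sets add: sets_circle)

lemma integrable_circle_bounded:
  fixes f :: "complex \<Rightarrow> 'b::{banach, second_countable_topology}"
  assumes "f \<in> borel_measurable circle" "\<And>z. cmod z = 1 \<Longrightarrow> norm (f z) \<le> B"
  shows "integrable circle f"
  using assms by (intro circle.integrable_const_bound[where B = B]) (auto intro!: AE_I2)

lemma integral_circle_powi: "(LINT z|circle. z powi n) = (if n = 0 then 1 else 0)"
proof (cases "n = 0")
  case True
  then show ?thesis using circle.prob_space by simp
next
  case False
  have meas: "(\<lambda>z. z powi n) \<in> borel_measurable circle"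
    by (rule borel_measurable_circle_continuous) (auto intro!: continuous_intros)
  define F where "F t = cis (real_of_int n * t) / (\<i> * of_int n)" for t
  have "(LINT z|circle. z powi n) = (LINT t|uniform_measure lborel {0..<2 * pi}. cis t powi n)"
    unfolding circle_def
    by (subst integral_distr) (use meas in \<open>auto cong: measurable_cong_sets simp: sets_circle\<close>)
  also have "\<dots> = (LINT t|lborel. (indicator {0..<2 * pi} t / (2 * pi)) *\<^sub>R cis t powi n)"
  proof -
    have "uniform_measure lborel {0..<2 * pi} = density lborel (\<lambda>t. ennreal (indicator {0..<2 * pi} t / (2 * pi)))"
      unfolding uniform_measure_def
      by (intro density_cong) (auto simp: indicator_def divide_ennreal[symmetric] intro!: AE_I2)
    moreover have "(\<lambda>t. cis t powi n) \<in> borel_measurable borel"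
      by (intro borel_measurable_continuous_onI continuous_intros) auto
    ultimately show ?thesis by (simp add: integral_density)
  qed
  also have "\<dots> = (LINT t|lborel. (1 / (2 * pi)) *\<^sub>R (indicator {0..2 * pi} t *\<^sub>R cis (real_of_int n * t)))"
  proof (rule integral_cong_AE)
    have [measurable]: "(\<lambda>t. cis t powi n) \<in> borel_measurable borel"
        "(\<lambda>t. cis (real_of_int n * t)) \<in> borel_measurable borel"
      by (intro borel_measurable_continuous_onI continuous_intros; simp)+
    show "(\<lambda>t. (indicator {0..<2 * pi} t / (2 * pi)) *\<^sub>R cis t powi n) \<in> borel_measurable lborel"
      "(\<lambda>t. (1 / (2 * pi)) *\<^sub>R (indicator {0..2 * pi} t *\<^sub>R cis (real_of_int n * t))) \<in> borel_measurable lborel"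
      by measurable
  qed (auto intro!: AE_I'[of "{2 * pi}"] simp: indicator_def cis_power_int)
  also have "\<dots> = (1 / (2 * pi)) *\<^sub>R (LINT t|lborel. indicator {0..2 * pi} t *\<^sub>R cis (real_of_int n * t))"
    by (rule integral_scaleR_right)
  also have "(LINT t|lborel. indicator {0..2 * pi} t *\<^sub>R cis (real_of_int n * t)) = F (2 * pi) - F 0"
  proof (rule integral_FTC_atLeastAtMost)
    fix t :: real
    show "(F has_vector_derivative cis (real_of_int n * t)) (at t within {0..2 * pi})"
    proof -
      have "((\<lambda>w. exp (\<i> * of_int n * w) / (\<i> * of_int n)) has_field_derivative
          cis (real_of_int n * t)) (at (complex_of_real t))"
        using False by (auto intro!: derivative_eq_intros simp: cis_conv_exp mult_ac)
      from has_vector_derivative_real_field[OF this] show ?thesis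
        by (simp add: F_def[abs_def] cis_conv_exp mult_ac)
    qed
  qed (auto intro!: continuous_intros)
  also have "F (2 * pi) = F 0"
    unfolding F_def using cis_multiple_2pi[of "real_of_int n"] by (simp add: mult_ac)
  finally show ?thesis using False by simp
qed

lemma borel_measurable_circle_powi [measurable]: "(\<lambda>z. z powi n) \<in> borel_measurable circle"
  by (rule borel_measurable_circle_continuous) (auto intro!: continuous_intros)

lemma norm_powi_circle: "cmod z = 1 \<Longrightarrow> cmod (z powi n) = 1"
  by (simp add: norm_power_int)

lemma integrable_circle_mult_bounded:
  fixes u g :: "complex \<Rightarrow> complex"
  assumes "integrable circle g" "u \<in> borel_measurable circle" "\<And>z. cmod z = 1 \<Longrightarrow> cmod (u z) \<le> B"
  shows "integrable circle (\<lambda>z. u z * g z)"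
proof (rule Bochner_Integration.integrable_bound[of circle "\<lambda>z. B * cmod (g z)"])
  show "integrable circle (\<lambda>z. B * cmod (g z))" using assms(1) by simp
  show "(\<lambda>z. u z * g z) \<in> borel_measurable circle" using assms by simp
  show "AE z in circle. cmod (u z * g z) \<le> norm (B * cmod (g z))"
    using assms(3) by (auto intro!: AE_I2 mult_right_mono order_trans[OF _ abs_ge_self] simp: norm_mult abs_mult)
qed

lemma fourier_coeff_diff:
  assumes "integrable circle g" "integrable circle h"
  shows "fourier_coeff (\<lambda>z. g z - h z) n = fourier_coeff g n - fourier_coeff h n"
proof -
  have "integrable circle (\<lambda>z. u z * z powi (- n))" if "integrable circle u" for u
    using integrable_circle_mult_bounded[OF that, of "\<lambda>z. z powi (- n)" 1]
    by (simp add: norm_powi_circle mult.commute)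
  from this[OF assms(1)] this[OF assms(2)] show ?thesis
    unfolding fourier_coeff_def left_diff_distrib by (rule Bochner_Integration.integral_diff)
qed

lemma fourier_coeff_zero_mult_powi:
  assumes "integrable circle g" "\<And>n. fourier_coeff g n = 0"
  shows "integrable circle (\<lambda>z. z powi m * g z)" "fourier_coeff (\<lambda>z. z powi m * g z) n = 0"
proof -
  show "integrable circle (\<lambda>z. z powi m * g z)"
    by (rule integrable_circle_mult_bounded[OF assms(1), of _ 1]) (auto simp: norm_powi_circle)
  have "fourier_coeff (\<lambda>z. z powi m * g z) n = fourier_coeff g (n - m)"
    unfolding fourier_coeff_def
  proof (rule Bochner_Integration.integral_cong[OF refl])
    fix z assume "z \<in> space circle"
    then have "z \<noteq> 0" by auto
    then have "z powi (- (n - m)) = z powi m * z powi (- n)"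
      by (subst power_int_add[symmetric]) simp_all
    then show "z powi m * g z * z powi (- n) = g z * z powi (- (n - m))" by simp
  qed
  then show "fourier_coeff (\<lambda>z. z powi m * g z) n = 0" using assms(2) by simp
qed

text \<open>
  The integrable functions all of whose Fourier coefficients vanish form a space that is invariant under
  multiplication by \<open>z\<close> and by \<open>1 / z\<close>, hence by every real polynomial in the coordinates of \<open>z\<close>.
\<close>

lemma fourier_coeff_zero_mult_polynomial:
  assumes "real_polynomial_function p"
    and "integrable circle g" "\<And>n. fourier_coeff g n = 0"
  shows "integrable circle (\<lambda>z. of_real (p z) * g z) \<and> (\<forall>n. fourier_coeff (\<lambda>z. of_real (p z) * g z) n = 0)"
  using assms
proof (induction p arbitrary: g rule: real_polynomial_function.induct)
  case (linear p)
  \<comment> \<open>On the circle \<open>Re z\<close> and \<open>Im z\<close> are combinations of \<open>z\<close> and \<open>1 / z\<close>, so a real linear form is \<open>a * z + b / z\<close>.\<close>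
  define a b where "a = (p 1 - \<i> * p \<i>) / 2" and "b = (p 1 + \<i> * p \<i>) / 2"
  have *: "of_real (p z) * g z = a * (z powi 1 * g z) + b * (z powi (-1) * g z)" if "z \<in> space circle" for z
  proof -
    have "z * cnj z = 1" using that by (simp add: complex_norm_square[symmetric])
    then have 1: "inverse z = cnj z" by (rule inverse_unique)
    have "p z = p (Re z *\<^sub>R 1 + Im z *\<^sub>R \<i>)"
      by (rule arg_cong[of _ _ p]) (simp add: complex_eq_iff)
    also have "\<dots> = Re z * p 1 + Im z * p \<i>"
      using linear(1) by (simp only: linear_add[OF bounded_linear.linear] linear_scale[OF bounded_linear.linear]) simp
    finally have "of_real (p z) = a * z + b * cnj z"
      by (auto simp: complex_eq_iff a_def b_def field_simps)
    then show ?thesis using 1 by (simp add: power_int_minus algebra_simps)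
  qed
  note i = fourier_coeff_zero_mult_powi[OF linear(2,3)]
  have **: "fourier_coeff (\<lambda>z. of_real (p z) * g z) n =
     a * fourier_coeff (\<lambda>z. z powi 1 * g z) n + b * fourier_coeff (\<lambda>z. z powi (-1) * g z) n" for n
  proof -
    have j: "integrable circle (\<lambda>z. (z powi m * g z) * z powi (- n))" for m
      using integrable_circle_mult_bounded[OF i(1), of "\<lambda>z. z powi (-n)" 1 m] by (simp add: norm_powi_circle mult_ac)
    have "fourier_coeff (\<lambda>z. of_real (p z) * g z) n =
      (LINT z|circle. a * ((z powi 1 * g z) * z powi (- n)) + b * ((z powi (-1) * g z) * z powi (- n)))"
      unfolding fourier_coeff_def
      by (rule Bochner_Integration.integral_cong[OF refl], subst *, assumption) (simp add: algebra_simps)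
    also have "\<dots> = a * fourier_coeff (\<lambda>z. z powi 1 * g z) n + b * fourier_coeff (\<lambda>z. z powi (-1) * g z) n"
      unfolding fourier_coeff_def
      by (subst Bochner_Integration.integral_add) (use j[of 1] j[of "-1"] in \<open>simp_all only: integrable_mult_right integral_mult_right_zero\<close>)
    finally show ?thesis .
  qed
  have "integrable circle (\<lambda>z. of_real (p z) * g z)"
    using i(1)[of 1] i(1)[of "-1"]
    by (subst Bochner_Integration.integrable_cong[OF refl *]) (simp_all only: Bochner_Integration.integrable_add integrable_mult_right)
  then show ?case unfolding ** i(2) by simp
next
  case (const c)
  then show ?case by (simp add: fourier_coeff_def mult.assoc)
next
  case (add p q)
  have P: "integrable circle (\<lambda>z. of_real (p z) * g z)" "fourier_coeff (\<lambda>z. of_real (p z) * g z) n = 0"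
   and Q: "integrable circle (\<lambda>z. of_real (q z) * g z)" "fourier_coeff (\<lambda>z. of_real (q z) * g z) n = 0" for n
    using add.IH add.prems by blast+
  have j: "integrable circle (\<lambda>z. h z * z powi (- n))" if "integrable circle h" for n h
    using integrable_circle_mult_bounded[OF that, of "\<lambda>z. z powi (-n)" 1] by (simp add: norm_powi_circle mult_ac)
  have "fourier_coeff (\<lambda>z. of_real (p z) * g z + of_real (q z) * g z) n = 0" for n
    using P(2)[of n] Q(2)[of n] j[OF P(1), of n] j[OF Q(1), of n] unfolding fourier_coeff_def
    by (simp add: distrib_right)
  then show ?case using P(1) Q(1) by (simp add: distrib_right)
next
  case (mult p q)
  have "integrable circle (\<lambda>z. of_real (q z) * g z)" "fourier_coeff (\<lambda>z. of_real (q z) * g z) n = 0" for n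
    using mult.IH(2) mult.prems by blast+
  from mult.IH(1)[OF this] show ?case by (simp add: mult.assoc)
qed

text \<open>
  Such a function integrates to zero against real polynomials, hence by the theorem of Stone and
  Weierstrass against continuous functions, hence over closed sets, and finally over all Borel sets
  because the closed sets are an intersection-stable generator.
\<close>

theorem AE_zero_if_fourier_coeff_zero:
  assumes g: "integrable circle g" "\<And>n. fourier_coeff g n = 0"
  shows "AE z in circle. g z = 0"
proof (rule circle.density_zero[OF g(1)])
  have cont: "(LINT z|circle. of_real (h z) * g z) = 0" if h: "continuous_on (sphere 0 1) h" for h :: "complex \<Rightarrow> real"
  proof -
    have "cmod (LINT z|circle. of_real (h z) * g z) \<le> e * (LINT z|circle. cmod (g z))" if e: "0 < e" for e
    proof -
      obtain p where p: "real_polynomial_function p" "\<And>z. z \<in> sphere 0 1 \<Longrightarrow> \<bar>h z - p z\<bar> < e"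
        using Stone_Weierstrass_real_polynomial_function[OF _ h e] by auto
      have pg: "integrable circle (\<lambda>z. of_real (p z) * g z)"
         "fourier_coeff (\<lambda>z. of_real (p z) * g z) 0 = 0"
        using fourier_coeff_zero_mult_polynomial[OF p(1) g] by blast+
      have "continuous_on (sphere 0 1) p"
        using p(1) by (simp add: continuous_on_polymonial_function real_polynomial_function_eq)
      then have hp: "(\<lambda>z. complex_of_real (h z - p z)) \<in> borel_measurable circle"
        using h by (intro borel_measurable_circle_continuous continuous_intros)
      have d: "integrable circle (\<lambda>z. of_real (h z - p z) * g z)"
        using p(2) by (intro integrable_circle_mult_bounded[OF g(1) hp, of e]) (simp add: less_imp_le del: of_real_diff)
      have "(LINT z|circle. of_real (h z) * g z) =
        (LINT z|circle. of_real (h z - p z) * g z + of_real (p z) * g z)"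
        by (simp add: algebra_simps)
      also have "\<dots> = (LINT z|circle. of_real (h z - p z) * g z)"
        using pg d by (subst Bochner_Integration.integral_add) (simp_all add: fourier_coeff_def)
      also have "cmod \<dots> \<le> (LINT z|circle. cmod (of_real (h z - p z) * g z))" by (rule integral_norm_bound)
      also have "\<dots> \<le> (LINT z|circle. e * cmod (g z))"
      proof (rule integral_mono)
        show "integrable circle (\<lambda>z. e * cmod (g z))" using g(1) by simp
        show "cmod (of_real (h z - p z) * g z) \<le> e * cmod (g z)" if "z \<in> space circle" for z
          unfolding norm_mult norm_of_real using p(2)[of z] that by (intro mult_right_mono) auto
      qed (rule integrable_norm[OF d])
      finally show ?thesis by simp
    qed
    moreover have "((\<lambda>e. e * (LINT z|circle. cmod (g z))) \<longlongrightarrow> 0 * (LINT z|circle. cmod (g z))) (at_right 0)"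
      by (intro tendsto_intros)
    ultimately have "cmod (LINT z|circle. of_real (h z) * g z) \<le> 0 * (LINT z|circle. cmod (g z))"
      by (intro tendsto_lowerbound) (auto simp: eventually_at_right_field gt_ex)
    then show ?thesis by simp
  qed
  have indicator: "(indicator A :: complex \<Rightarrow> real) \<in> borel_measurable circle" if "A \<in> sets borel" for A
    using that borel_measurable_indicator[of A borel]
    by (simp add: measurable_cong_sets[OF sets_circle refl] measurable_restrict_space1)
  have closed: "(LINT z|circle. indicator F z *\<^sub>R g z) = 0" if F: "closed F" for F :: "complex set"
  proof (cases "F = {}")
    case False
    \<comment> \<open>Continuous functions decreasing to the indicator function of \<open>F\<close>.\<close>
    define h where "h n z = max 0 (1 - real n * infdist z F)" for n z
    have hc: "continuous_on S (h n)" for n S unfolding h_def by (intro continuous_intros)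
    have "(\<lambda>n. LINT z|circle. of_real (h n z) * g z) \<longlonglongrightarrow> (LINT z|circle. indicator F z *\<^sub>R g z)"
    proof (rule integral_dominated_convergence[where w = "\<lambda>z. cmod (g z)"])
      show "(\<lambda>z. indicator F z *\<^sub>R g z) \<in> borel_measurable circle"
        using indicator[of F] borel_closed[OF F] g(1) by (intro borel_measurable_scaleR) auto
      show "(\<lambda>z. of_real (h n z) * g z) \<in> borel_measurable circle" for n
        using g(1) borel_measurable_circle_continuous[OF hc] by auto
      show "AE z in circle. (\<lambda>n. of_real (h n z) * g z) \<longlonglongrightarrow> indicator F z *\<^sub>R g z"
      proof (rule AE_I2)
        fix z
        have "(\<lambda>n. h n z) \<longlonglongrightarrow> indicator F z"
        proof (cases "z \<in> F")
          case False
          then have "0 < infdist z F"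
            using in_closed_iff_infdist_zero[OF F \<open>F \<noteq> {}\<close>, of z] infdist_nonneg[of z F] by simp
          then have "eventually (\<lambda>n. h n z = 0) sequentially"
          proof -
            obtain N where N: "1 < real N * infdist z F"
              using ex_less_of_nat_mult[OF \<open>0 < infdist z F\<close>] by auto
            have "h n z = 0" if "N \<le> n" for n
            proof -
              have "real N * infdist z F \<le> real n * infdist z F"
                using that by (intro mult_right_mono) (auto simp: infdist_nonneg)
              then show ?thesis using N by (simp add: h_def)
            qed
            then show ?thesis by (auto simp: eventually_sequentially)
          qed
          then show ?thesis using False by (simp add: tendsto_eventually)
        qed (simp add: h_def)
        then have "(\<lambda>n. of_real (h n z) * g z) \<longlonglongrightarrow> of_real (indicator F z) * g z" by (intro tendsto_intros)
        then show "(\<lambda>n. of_real (h n z) * g z) \<longlonglongrightarrow> indicator F z *\<^sub>R g z" by (simp add: scaleR_conv_of_real)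
      qed
      show "AE z in circle. cmod (of_real (h n z) * g z) \<le> cmod (g z)" for n
        by (auto intro!: AE_I2 mult_left_le_one_le simp: norm_mult h_def infdist_nonneg)
    qed (use g(1) in simp)
    then show ?thesis using cont[OF hc] by (simp add: LIMSEQ_const_iff)
  qed simp
  have borel: "(LINT z|circle. indicator A z *\<^sub>R g z) = 0" if "A \<in> sets borel" for A :: "complex set"
  proof -
    have int: "integrable circle (\<lambda>z. indicator A z *\<^sub>R g z)" if "A \<in> sets borel" for A
      unfolding scaleR_conv_of_real
    proof (rule integrable_circle_mult_bounded[OF g(1), of _ 1])
      show "(\<lambda>z. complex_of_real (indicator A z)) \<in> borel_measurable circle"
        using indicator[OF that] by measurable
    qed (auto simp: indicator_def)
    have whole: "(LINT z|circle. g z) = 0" using g(2)[of 0] by (simp add: fourier_coeff_def)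
    have sb: "sigma_sets UNIV (Collect closed) = sets (borel :: complex measure)"
      by (simp add: borel_eq_closed)
    have "Int_stable (Collect closed :: complex set set)" by (auto simp: Int_stable_def)
    moreover have "Collect closed \<subseteq> Pow (UNIV :: complex set)" by simp
    moreover have "A \<in> sigma_sets UNIV (Collect closed)" using that by (simp add: sb)
    ultimately show ?thesis
    proof (induction A rule: sigma_sets_induct_disjoint)
      case (compl A)
      then have "A \<in> sets borel" by (simp add: sb)
      have "(LINT z|circle. indicator (UNIV - A) z *\<^sub>R g z) = (LINT z|circle. g z - indicator A z *\<^sub>R g z)"
        by (intro Bochner_Integration.integral_cong) (auto simp: indicator_def)
      also have "\<dots> = 0"
        using compl int[OF \<open>A \<in> sets borel\<close>] g(1) whole by simp
      finally show ?case .
    next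
      case (union A)
      then have A: "A i \<in> sets borel" for i by (auto simp: sb)
      have restr: "set_lebesgue_integral circle (sphere 0 1 \<inter> B) g = (LINT z|circle. indicator B z *\<^sub>R g z)" for B
        unfolding set_lebesgue_integral_def by (intro Bochner_Integration.integral_cong) (auto simp: indicator_def)
      have meas: "sphere 0 1 \<inter> B \<in> sets circle" if "B \<in> sets borel" for B
        using that by (auto simp: sets_circle sets_restrict_space)
      have U: "(\<Union>i. sphere 0 1 \<inter> A i) = sphere 0 1 \<inter> (\<Union>i. A i)" by blast
      have "set_lebesgue_integral circle (\<Union>i. sphere 0 1 \<inter> A i) g = (\<Sum>i. set_lebesgue_integral circle (sphere 0 1 \<inter> A i) g)"
      proof (rule lebesgue_integral_countable_add)
        show "set_integrable circle (\<Union>i. sphere 0 1 \<inter> A i) g"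
          unfolding U set_integrable_def using A meas[of "\<Union>i. A i"]
          by (intro integrable_mult_indicator g(1)) auto
        show "(sphere 0 1 \<inter> A i) \<inter> (sphere 0 1 \<inter> A j) = {}" if "i \<noteq> j" for i j
          using disjoint_family_onD[OF union(1) UNIV_I UNIV_I that] by blast
      qed (use A meas in auto)
      then show ?case by (simp add: U restr union)
    qed (auto simp: closed)
  qed
  fix A assume A: "A \<in> sets circle"
  then obtain B where "B \<in> sets borel" "A = sphere 0 1 \<inter> B"
    by (auto simp: sets_circle sets_restrict_space)
  then have "set_lebesgue_integral circle A g = (LINT z|circle. indicator B z *\<^sub>R g z)"
    unfolding set_lebesgue_integral_def
    by (intro Bochner_Integration.integral_cong) (auto simp: indicator_def)
  then show "set_lebesgue_integral circle A g = 0" using borel[OF \<open>B \<in> sets borel\<close>] by simp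
qed

section \<open>Square-integrable functions\<close>

lemma L2_measurable [measurable_dest]: "f \<in> L2 \<Longrightarrow> f \<in> borel_measurable circle"
  by (simp add: L2_def)

lemma borel_measurable_cnj [measurable]: "cnj \<in> borel_measurable borel"
  by (intro borel_measurable_continuous_onI continuous_intros)

lemma L2_I: "f \<in> borel_measurable circle \<Longrightarrow> integrable circle (\<lambda>z. (cmod (f z))\<^sup>2) \<Longrightarrow> f \<in> L2"
  by (simp add: L2_def)

lemma L2_norm_nonneg: "0 \<le> L2_norm f"
  by (simp add: L2_norm_def)

lemma L2_bounded:
  assumes "f \<in> borel_measurable circle" "\<And>z. cmod z = 1 \<Longrightarrow> cmod (f z) \<le> B"
  shows "f \<in> L2"
proof -
  have "integrable circle (\<lambda>z. (cmod (f z))\<^sup>2)"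
    by (rule integrable_circle_bounded[where B = "B\<^sup>2"]) (use assms in \<open>auto intro!: power_mono\<close>)
  then show ?thesis using assms by (simp add: L2_def)
qed

lemma L2_add:
  assumes "f \<in> L2" "g \<in> L2"
  shows "(\<lambda>z. f z + g z) \<in> L2"
proof -
  have "integrable circle (\<lambda>z. (cmod (f z + g z))\<^sup>2)"
  proof (rule Bochner_Integration.integrable_bound)
    show "integrable circle (\<lambda>z. 2 * (cmod (f z))\<^sup>2 + 2 * (cmod (g z))\<^sup>2)"
      using assms by (simp add: L2_def)
    have "(cmod (f z + g z))\<^sup>2 \<le> 2 * (cmod (f z))\<^sup>2 + 2 * (cmod (g z))\<^sup>2" for z
    proof -
      have "(cmod (f z + g z))\<^sup>2 \<le> (cmod (f z) + cmod (g z))\<^sup>2"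
        by (intro power_mono norm_triangle_ineq) simp
      also have "\<dots> \<le> 2 * (cmod (f z))\<^sup>2 + 2 * (cmod (g z))\<^sup>2"
        using zero_le_power2[of "cmod (f z) - cmod (g z)"] by (simp add: power2_eq_square algebra_simps)
      finally show ?thesis .
    qed
    then show "AE z in circle. norm ((cmod (f z + g z))\<^sup>2) \<le> norm (2 * (cmod (f z))\<^sup>2 + 2 * (cmod (g z))\<^sup>2)"
      by (intro AE_I2) (simp add: abs_le_iff order_trans)
  qed (use assms in measurable)
  then show ?thesis by (intro L2_I) (use assms in measurable)
qed

lemma L2_mult_bounded:
  assumes "f \<in> L2" "w \<in> borel_measurable circle" "\<And>z. cmod z = 1 \<Longrightarrow> cmod (w z) \<le> B"
  shows "(\<lambda>z. w z * f z) \<in> L2" "L2_norm (\<lambda>z. w z * f z) \<le> B * L2_norm f"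
proof -
  have "cmod (w 1) \<le> B" by (rule assms(3)) simp
  then have B: "0 \<le> B" using norm_ge_zero order_trans by blast
  have le: "(cmod (w z * f z))\<^sup>2 \<le> B\<^sup>2 * (cmod (f z))\<^sup>2" if "cmod z = 1" for z
    unfolding norm_mult power_mult_distrib using assms(3)[OF that] by (intro mult_right_mono power_mono) auto
  have int: "integrable circle (\<lambda>z. B\<^sup>2 * (cmod (f z))\<^sup>2)" using assms(1) by (simp add: L2_def)
  have int': "integrable circle (\<lambda>z. (cmod (w z * f z))\<^sup>2)"
    by (rule Bochner_Integration.integrable_bound[OF int]) (use assms le in \<open>auto intro!: AE_I2\<close>)
  then show "(\<lambda>z. w z * f z) \<in> L2" by (intro L2_I) (use assms in measurable)
  have "(LINT z|circle. (cmod (w z * f z))\<^sup>2) \<le> (LINT z|circle. B\<^sup>2 * (cmod (f z))\<^sup>2)"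
    using int int' le by (intro integral_mono) auto
  then have "L2_norm (\<lambda>z. w z * f z) \<le> sqrt (B\<^sup>2 * (LINT z|circle. (cmod (f z))\<^sup>2))"
    unfolding L2_norm_def by simp
  then show "L2_norm (\<lambda>z. w z * f z) \<le> B * L2_norm f"
    using B by (simp add: real_sqrt_mult L2_norm_def)
qed

lemma L2_cmult: "f \<in> L2 \<Longrightarrow> (\<lambda>z. c * f z) \<in> L2"
  by (rule L2_mult_bounded(1)[of f "\<lambda>_. c" "cmod c"]) auto

lemma L2_diff: "f \<in> L2 \<Longrightarrow> g \<in> L2 \<Longrightarrow> (\<lambda>z. f z - g z) \<in> L2"
  using L2_add[OF _ L2_cmult[of g "-1"]] by simp

lemma L2_sum: "(\<And>i. i \<in> I \<Longrightarrow> f i \<in> L2) \<Longrightarrow> (\<lambda>z. \<Sum>i\<in>I. f i z) \<in> L2"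
  by (induction I rule: infinite_finite_induct)
    (auto intro: L2_add L2_bounded[of "\<lambda>_. 0" 0])

lemma L2_mult_integrable:
  assumes "f \<in> L2" "g \<in> L2"
  shows "integrable circle (\<lambda>z. cmod (f z) * cmod (g z))"
    and "integrable circle (\<lambda>z. f z * cnj (g z))"
proof -
  have "integrable circle (\<lambda>z. (cmod (f z))\<^sup>2 + (cmod (g z))\<^sup>2)"
    using assms by (simp add: L2_def)
  then show 1: "integrable circle (\<lambda>z. cmod (f z) * cmod (g z))"
  proof (rule Bochner_Integration.integrable_bound)
    have "cmod (f z) * cmod (g z) \<le> (cmod (f z))\<^sup>2 + (cmod (g z))\<^sup>2" for z
      using sum_squares_bound[of "cmod (f z)" "cmod (g z)"]
        mult_nonneg_nonneg[OF norm_ge_zero[of "f z"] norm_ge_zero[of "g z"]] by linarith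
    then show "AE z in circle. norm (cmod (f z) * cmod (g z)) \<le> norm ((cmod (f z))\<^sup>2 + (cmod (g z))\<^sup>2)"
      by (intro AE_I2) simp
  qed (use assms in measurable)
  show "integrable circle (\<lambda>z. f z * cnj (g z))"
  proof (rule Bochner_Integration.integrable_bound[OF 1])
    show "(\<lambda>z. f z * cnj (g z)) \<in> borel_measurable circle"
      using assms by measurable
  qed (simp add: norm_mult)
qed

text \<open>
  Nonnegativity of the integral of \<open>(|f| - x |g|)\<^sup>2\<close> for all real \<open>x\<close>.
\<close>

lemma L2_Cauchy_Schwarz:
  assumes f: "f \<in> L2" and g: "g \<in> L2"
  shows "cmod (L2_inner f g) \<le> L2_norm f * L2_norm g"
proof -
  define A B C where "A = (LINT z|circle. (cmod (f z))\<^sup>2)" and "B = (LINT z|circle. (cmod (g z))\<^sup>2)"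
    and "C = (LINT z|circle. cmod (f z) * cmod (g z))"
  have int: "integrable circle (\<lambda>z. (cmod (f z))\<^sup>2)" "integrable circle (\<lambda>z. (cmod (g z))\<^sup>2)"
    using f g by (auto simp: L2_def)
  have quad: "0 \<le> A - 2 * x * C + x\<^sup>2 * B" for x
  proof -
    have "0 \<le> (LINT z|circle. (cmod (f z) - x * cmod (g z))\<^sup>2)" by simp
    also have "\<dots> = (LINT z|circle. (cmod (f z))\<^sup>2 - 2 * x * (cmod (f z) * cmod (g z)) + x\<^sup>2 * (cmod (g z))\<^sup>2)"
      by (simp add: power2_eq_square algebra_simps)
    also have "\<dots> = A - 2 * x * C + x\<^sup>2 * B"
      using int L2_mult_integrable(1)[OF f g] by (simp add: A_def B_def C_def)
    finally show ?thesis .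
  qed
  have A0: "0 \<le> A" and B0: "0 \<le> B" and C0: "0 \<le> C" by (simp_all add: A_def B_def C_def)
  have "C\<^sup>2 \<le> A * B"
  proof (cases "B = 0")
    case True
    have "C = 0"
    proof (rule ccontr)
      assume "C \<noteq> 0"
      then show False using quad[of "(A + 1) / (2 * C)"] True C0 by simp
    qed
    then show ?thesis using A0 B0 by simp
  next
    case False
    have "0 \<le> A - 2 * (C / B) * C + (C / B)\<^sup>2 * B" by (rule quad)
    also have "\<dots> = A - C\<^sup>2 / B" using False by (simp add: power2_eq_square field_simps)
    finally show ?thesis using False B0 by (simp add: field_simps)
  qed
  then have "C \<le> sqrt (A * B)" by (rule real_le_rsqrt)
  moreover have "cmod (L2_inner f g) \<le> C"
    unfolding L2_inner_def C_def using integral_norm_bound[of circle "\<lambda>z. f z * cnj (g z)"] by (simp add: norm_mult)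
  ultimately show ?thesis by (simp add: L2_norm_def A_def B_def real_sqrt_mult)
qed

lemma L2_inner_add_left:
  "f \<in> L2 \<Longrightarrow> g \<in> L2 \<Longrightarrow> k \<in> L2 \<Longrightarrow> L2_inner (\<lambda>z. f z + g z) k = L2_inner f k + L2_inner g k"
  using L2_mult_integrable(2)[of f k] L2_mult_integrable(2)[of g k] by (simp add: L2_inner_def distrib_right)

lemma L2_inner_diff_left:
  "f \<in> L2 \<Longrightarrow> g \<in> L2 \<Longrightarrow> k \<in> L2 \<Longrightarrow> L2_inner (\<lambda>z. f z - g z) k = L2_inner f k - L2_inner g k"
  using L2_mult_integrable(2)[of f k] L2_mult_integrable(2)[of g k] by (simp add: L2_inner_def left_diff_distrib)

lemma L2_inner_diff_right:
  "f \<in> L2 \<Longrightarrow> g \<in> L2 \<Longrightarrow> k \<in> L2 \<Longrightarrow> L2_inner k (\<lambda>z. f z - g z) = L2_inner k f - L2_inner k g"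
  using L2_mult_integrable(2)[of k f] L2_mult_integrable(2)[of k g] by (simp add: L2_inner_def right_diff_distrib)

lemma L2_inner_cmult_left: "L2_inner (\<lambda>z. c * f z) k = c * L2_inner f k"
  by (simp add: L2_inner_def mult.assoc)

lemma L2_inner_sum_left:
  assumes "\<And>i. i \<in> I \<Longrightarrow> f i \<in> L2" "k \<in> L2"
  shows "L2_inner (\<lambda>z. \<Sum>i\<in>I. f i z) k = (\<Sum>i\<in>I. L2_inner (f i) k)"
  unfolding L2_inner_def sum_distrib_right
  by (rule Bochner_Integration.integral_sum) (use assms L2_mult_integrable(2) in blast)

lemma L2_inner_cnj: "L2_inner g f = cnj (L2_inner f g)"
  using Bochner_Integration.integral_cnj[of circle "\<lambda>z. f z * cnj (g z)"]
  by (simp add: L2_inner_def mult.commute)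

lemma L2_inner_cmult_right: "L2_inner k (\<lambda>z. a * f z) = cnj a * L2_inner k f"
  using L2_inner_cnj[of k "\<lambda>z. a * f z"] L2_inner_cnj[of k f] by (simp add: L2_inner_cmult_left)

lemma L2_inner_sum_right:
  assumes "\<And>i. i \<in> I \<Longrightarrow> f i \<in> L2" "k \<in> L2"
  shows "L2_inner k (\<lambda>z. \<Sum>i\<in>I. f i z) = (\<Sum>i\<in>I. L2_inner k (f i))"
  by (subst L2_inner_cnj) (simp add: L2_inner_sum_left[OF assms] L2_inner_cnj[of k])

lemma L2_inner_cong:
  "(\<And>z. cmod z = 1 \<Longrightarrow> f z = g z) \<Longrightarrow> (\<And>z. cmod z = 1 \<Longrightarrow> h z = k z) \<Longrightarrow> L2_inner f h = L2_inner g k"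
  unfolding L2_inner_def by (intro Bochner_Integration.integral_cong) auto

lemma tendsto_L2_inner:
  assumes "\<And>n. u n \<in> L2" "u' \<in> L2" "\<And>n. v n \<in> L2" "v' \<in> L2"
    and "(\<lambda>n::nat. L2_norm (\<lambda>z. u' z - u n z)) \<longlonglongrightarrow> 0"
    and "(\<lambda>n. L2_norm (\<lambda>z. v' z - v n z)) \<longlonglongrightarrow> 0"
  shows "(\<lambda>n. L2_inner (u n) (v n)) \<longlonglongrightarrow> L2_inner u' v'"
proof -
  let ?du = "\<lambda>n z. u' z - u n z" and ?dv = "\<lambda>n z. v' z - v n z"
  have d: "?du n \<in> L2" "?dv n \<in> L2" for n using assms by (auto intro: L2_diff)
  have z: "(\<lambda>n. L2_inner (a n) (b n)) \<longlonglongrightarrow> 0"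
    if "\<And>n. a n \<in> L2" "\<And>n. b n \<in> L2" "(\<lambda>n. L2_norm (a n) * L2_norm (b n)) \<longlonglongrightarrow> 0" for a b :: "nat \<Rightarrow> complex \<Rightarrow> complex"
    by (rule Lim_null_comparison[OF _ that(3)]) (use L2_Cauchy_Schwarz that in auto)
  have "(\<lambda>n. L2_inner u' v' - L2_inner u' (?dv n) - L2_inner (?du n) v' + L2_inner (?du n) (?dv n))
     \<longlonglongrightarrow> L2_inner u' v' - 0 - 0 + 0"
  proof (intro tendsto_intros z d assms(2,4))
    show "(\<lambda>n. L2_norm u' * L2_norm (?dv n)) \<longlonglongrightarrow> 0"
      using tendsto_mult_right_zero[OF assms(6)] .
    show "(\<lambda>n. L2_norm (?du n) * L2_norm v') \<longlonglongrightarrow> 0"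
      using tendsto_mult_left_zero[OF assms(5)] .
    show "(\<lambda>n. L2_norm (?du n) * L2_norm (?dv n)) \<longlonglongrightarrow> 0"
      using tendsto_mult_zero[OF assms(5,6)] .
  qed
  moreover have "L2_inner u' v' - L2_inner u' (?dv n) - L2_inner (?du n) v' + L2_inner (?du n) (?dv n)
     = L2_inner (u n) (v n)" for n
    by (simp add: L2_inner_diff_left L2_inner_diff_right assms d)
  ultimately show ?thesis by simp
qed

lemma L2_norm_zero [simp]: "L2_norm (\<lambda>z. 0) = 0"
  by (simp add: L2_norm_def)

lemma L2_norm_le_bound:
  assumes "f \<in> borel_measurable circle" "\<And>z. cmod z = 1 \<Longrightarrow> cmod (f z) \<le> B"
  shows "L2_norm f \<le> B"
proof -
  have "L2_norm (\<lambda>_. 1) = 1" using circle.prob_space by (simp add: L2_norm_def)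
  then show ?thesis
    using L2_mult_bounded(2)[OF L2_bounded[of "\<lambda>_. 1" 1] assms] by simp
qed

lemma L2_tendsto_if_uniform:
  assumes "\<And>n. f n \<in> borel_measurable circle" "\<And>n z. cmod z = 1 \<Longrightarrow> cmod (f n z) \<le> b n" "b \<longlonglongrightarrow> 0"
  shows "(\<lambda>n. L2_norm (f n)) \<longlonglongrightarrow> 0"
  by (rule Lim_null_comparison[OF _ assms(3)])
    (use L2_norm_le_bound[OF assms(1,2)] L2_norm_nonneg in auto)

section \<open>Absolutely convergent trigonometric series\<close>

text \<open>
  One-sided series in selected modes. The modes \<open>int n\<close> give power series, the modes \<open>int n + 1\<close> functions
  in \<open>H2_0\<close> and the modes \<open>- int n\<close> functions in \<open>H2_minus\<close>.
\<close>

definition trig_series :: "(nat \<Rightarrow> int) \<Rightarrow> (nat \<Rightarrow> complex) \<Rightarrow> complex \<Rightarrow> complex" where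
  "trig_series s a z = (\<Sum>n. a n * z powi s n)"

lemma L2_powi: "(\<lambda>z. z powi n) \<in> L2"
  by (rule L2_bounded[where B = 1]) (auto simp: norm_powi_circle)

lemma powi_minus_circle:
  assumes "cmod z = 1"
  shows "z powi - n = cnj (z powi n)"
proof -
  have "z powi n * cnj (z powi n) = 1"
    unfolding complex_norm_square[symmetric] by (simp add: norm_powi_circle assms)
  then have "inverse (z powi n) = cnj (z powi n)" by (rule inverse_unique)
  then show ?thesis by (simp add: power_int_minus)
qed

lemma fourier_coeff_eq_L2_inner: "fourier_coeff f n = L2_inner f (\<lambda>z. z powi n)"
  unfolding fourier_coeff_def L2_inner_def
  by (rule Bochner_Integration.integral_cong) (simp_all add: powi_minus_circle)

lemma L2_inner_powi: "L2_inner (\<lambda>z. z powi i) (\<lambda>z. z powi j) = (if i = j then 1 else 0)"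
proof -
  have "L2_inner (\<lambda>z. z powi i) (\<lambda>z. z powi j) = (LINT z|circle. z powi (i - j))"
    unfolding fourier_coeff_eq_L2_inner[symmetric] fourier_coeff_def
  proof (rule Bochner_Integration.integral_cong[OF refl])
    fix z :: complex assume "z \<in> space circle"
    then have "z \<noteq> 0" by auto
    then show "z powi i * z powi - j = z powi (i - j)"
      using power_int_add[of z i "- j"] by simp
  qed
  then show ?thesis by (simp add: integral_circle_powi)
qed

lemma trig_series_summable:
  assumes "summable (\<lambda>n. cmod (a n))" "cmod z = 1"
  shows "summable (\<lambda>n. a n * z powi s n)"
  by (rule summable_norm_cancel) (simp add: norm_mult norm_powi_circle assms)

lemma trig_series_measurable [measurable]:
  "trig_series s a \<in> borel_measurable circle"
  unfolding trig_series_def[abs_def] by measurable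

lemma trig_series_tail:
  assumes "summable (\<lambda>n. cmod (a n))" "cmod z = 1"
  shows "cmod (trig_series s a z - (\<Sum>n<N. a n * z powi s n)) \<le> (\<Sum>n. cmod (a (n + N)))"
proof -
  have s: "summable (\<lambda>n. cmod (a (n + N) * z powi s (n + N)))"
    using summable_ignore_initial_segment[OF assms(1), of N] by (simp add: norm_mult norm_powi_circle assms(2))
  have "trig_series s a z - (\<Sum>n<N. a n * z powi s n) = (\<Sum>n. a (n + N) * z powi s (n + N))"
    unfolding trig_series_def using suminf_split_initial_segment[OF trig_series_summable[OF assms], of s N] by simp
  also have "cmod \<dots> \<le> (\<Sum>n. cmod (a (n + N) * z powi s (n + N)))" by (rule summable_norm[OF s])
  finally show ?thesis by (simp add: norm_mult norm_powi_circle assms(2))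
qed

lemma trig_series_L2: "summable (\<lambda>n. cmod (a n)) \<Longrightarrow> trig_series s a \<in> L2"
  using trig_series_tail[of a _ s 0] by (intro L2_bounded[of _ "\<Sum>n. cmod (a n)"]) auto

lemma trig_sum_L2: "(\<lambda>z. \<Sum>n\<in>I. a n * z powi s n) \<in> L2"
  by (intro L2_sum L2_cmult L2_powi)

lemma trig_series_L2_tendsto:
  assumes "summable (\<lambda>n. cmod (a n))"
  shows "(\<lambda>N. L2_norm (\<lambda>z. trig_series s a z - (\<Sum>n<N. a n * z powi s n))) \<longlonglongrightarrow> 0"
  by (rule L2_tendsto_if_uniform[where b = "\<lambda>N. \<Sum>n. cmod (a (n + N))"])
    (auto intro!: trig_series_tail suminf_exist_split2 assms)

lemma L2_inner_trig_series:
  assumes "summable (\<lambda>n. cmod (a n))" "k \<in> L2"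
  shows "(\<lambda>n. a n * L2_inner (\<lambda>z. z powi s n) k) sums L2_inner (trig_series s a) k"
proof -
  have "(\<lambda>N. L2_inner (\<lambda>z. \<Sum>n<N. a n * z powi s n) k) \<longlonglongrightarrow> L2_inner (trig_series s a) k"
    by (rule tendsto_L2_inner) (use assms trig_series_L2 trig_series_L2_tendsto trig_sum_L2 in auto)
  moreover have "L2_inner (\<lambda>z. \<Sum>n<N. a n * z powi s n) k = (\<Sum>n<N. a n * L2_inner (\<lambda>z. z powi s n) k)" for N
    by (subst L2_inner_sum_left) (auto simp: L2_inner_cmult_left assms intro: L2_cmult L2_powi)
  ultimately show ?thesis by (simp add: sums_def)
qed

lemma fourier_coeff_trig_series:
  assumes "summable (\<lambda>n. cmod (a n))"
  shows "(\<lambda>n. a n * (if s n = m then 1 else 0)) sums fourier_coeff (trig_series s a) m"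
  using L2_inner_trig_series[OF assms L2_powi, of s m]
  by (simp only: L2_inner_powi fourier_coeff_eq_L2_inner)

lemma fourier_coeff_trig_series_range:
  assumes "summable (\<lambda>n. cmod (a n))" "inj s"
  shows "fourier_coeff (trig_series s a) (s i) = a i"
proof -
  have "(\<lambda>n. a n * (if s n = s i then 1 else 0)) = (\<lambda>n. if n = i then a n else 0)"
    using assms(2) by (auto simp: inj_eq)
  then show ?thesis
    using fourier_coeff_trig_series[OF assms(1), of s "s i"] sums_single[of i a] sums_unique2 by metis
qed

lemma fourier_coeff_trig_series_outside:
  assumes "summable (\<lambda>n. cmod (a n))" "m \<notin> range s"
  shows "fourier_coeff (trig_series s a) m = 0"
proof -
  have "(\<lambda>n. a n * (if s n = m then 1 else 0)) = (\<lambda>n. 0)"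
    using assms(2) by (auto simp: fun_eq_iff)
  then show ?thesis
    using fourier_coeff_trig_series[OF assms(1), of s m] sums_zero sums_unique2 by metis
qed

lemma trig_series_sum:
  assumes "\<And>k. k \<in> Q \<Longrightarrow> summable (\<lambda>n. cmod (b k n))" "cmod z = 1"
  shows "trig_series s (\<lambda>n. \<Sum>k\<in>Q. a k * b k n) z = (\<Sum>k\<in>Q. a k * trig_series s (b k) z)"
proof -
  have S: "summable (\<lambda>n. b k n * z powi s n)" if "k \<in> Q" for k
    by (rule trig_series_summable) (use assms that in auto)
  have "(\<Sum>n. (\<Sum>k\<in>Q. a k * b k n) * z powi s n) = (\<Sum>n. \<Sum>k\<in>Q. a k * (b k n * z powi s n))"
    by (simp add: sum_distrib_right mult.assoc)
  also have "\<dots> = (\<Sum>k\<in>Q. \<Sum>n. a k * (b k n * z powi s n))"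
    by (rule suminf_sum) (use S in \<open>auto intro: summable_mult\<close>)
  also have "\<dots> = (\<Sum>k\<in>Q. a k * (\<Sum>n. b k n * z powi s n))"
    by (intro sum.cong refl suminf_mult S)
  finally show ?thesis by (simp add: trig_series_def)
qed

lemma geometric_coeffs_summable:
  fixes b :: "nat \<Rightarrow> complex"
  assumes "\<And>l. cmod (b l) \<le> M * r ^ l" "0 < r" "r < 1"
  shows "summable (\<lambda>l. cmod (b l))"
  by (rule summable_comparison_test'[of "\<lambda>l. M * r ^ l"]) (use assms in \<open>auto intro!: summable_mult\<close>)

text \<open>
  The power series with coefficients \<open>b\<close> converges in the disc of radius \<open>1 / r > 1\<close>. The map taking \<open>w\<close>
  to \<open>exp (- \<i> * w)\<close> sends the strip \<open>Im w < ln (1 / r)\<close> into this disc and the real line onto the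
  circle, so the composition is holomorphic in a ball around each real point.
\<close>

lemma real_analytic_trig_series:
  assumes b: "\<And>l. cmod (b l) \<le> M * r ^ l" and r: "0 < r" "r < 1"
  shows "real_analytic_on_circle (trig_series (\<lambda>n. - int n) b)"
  unfolding real_analytic_on_circle_def
proof
  fix t0 :: real
  define P where "P w = (\<Sum>l. b l * w ^ l)" for w
  define \<rho> where "\<rho> = ln (1 / r)"
  have "0 < \<rho>" using r by (simp add: \<rho>_def)
  have "P holomorphic_on ball 0 (1 / r)"
  proof (rule power_series_holomorphic)
    fix w :: complex assume "w \<in> ball 0 (1 / r)"
    then have w: "r * cmod w < 1" using r by (simp add: field_simps)
    have "summable (\<lambda>l. b l * w ^ l)"
    proof (rule summable_comparison_test')
      show "summable (\<lambda>l. M * (r * cmod w) ^ l)"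
        using w r by (intro summable_mult summable_geometric) (simp add: abs_mult)
      show "norm (b l * w ^ l) \<le> M * (r * cmod w) ^ l" for l
        using mult_right_mono[OF b[of l], of "cmod w ^ l"] by (simp add: norm_mult norm_power power_mult_distrib mult_ac)
    qed
    then show "(\<lambda>l. b l * (w - 0) ^ l) sums P w" by (simp add: P_def summable_sums)
  qed
  moreover have "(\<lambda>w. exp (- \<i> * w)) ` ball (of_real t0) \<rho> \<subseteq> ball 0 (1 / r)"
  proof safe
    fix w assume "w \<in> ball (complex_of_real t0) \<rho>"
    then have "Im w < \<rho>"
      using abs_Im_le_cmod[of "of_real t0 - w"] by (simp add: dist_norm)
    then have "exp (Im w) < 1 / r" using r by (simp add: \<rho>_def ln_div exp_minus) (metis exp_less_mono exp_ln exp_minus inverse_eq_divide)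
    then show "exp (- \<i> * w) \<in> ball 0 (1 / r)" by (simp add: norm_exp_eq_Re)
  qed
  ultimately have "(P \<circ> (\<lambda>w. exp (- \<i> * w))) holomorphic_on ball (of_real t0) \<rho>"
    by (intro holomorphic_on_compose_gen[where t = "ball 0 (1 / r)"] holomorphic_intros) auto
  note ps = holomorphic_power_series[OF this]
  define F where "F = P \<circ> (\<lambda>w. exp (- \<i> * w))"
  have F: "F (of_real t) = trig_series (\<lambda>n. - int n) b (cis t)" for t
    by (simp add: F_def P_def trig_series_def power_int_minus cis_conv_exp exp_minus power_inverse)
  show "\<exists>\<rho>>0. \<exists>a. \<forall>t. \<bar>t - t0\<bar> < \<rho> \<longrightarrow>
        (\<lambda>n. a n * of_real ((t - t0) ^ n)) sums trig_series (\<lambda>n. - int n) b (cis t)"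
  proof (intro exI conjI allI impI)
    fix t assume "\<bar>t - t0\<bar> < \<rho>"
    then have "of_real t \<in> ball (complex_of_real t0) \<rho>"
      by (simp add: dist_norm abs_minus_commute flip: of_real_diff)
    from ps[OF this, folded F_def]
    show "(\<lambda>n. ((deriv ^^ n) F (of_real t0) / fact n) * of_real ((t - t0) ^ n)) sums
       trig_series (\<lambda>n. - int n) b (cis t)"
      by (simp add: F)
  qed fact
qed

section \<open>Hardy spaces and the projection onto the non-positive modes\<close>

lemma H2_fourier_coeff:
  assumes g: "g \<in> L2" and b: "(\<lambda>N. L2_norm (\<lambda>z. g z - (\<Sum>n<N. b n * z ^ n))) \<longlonglongrightarrow> 0"
  shows "fourier_coeff g m = (if 0 \<le> m then b (nat m) else 0)"
proof -
  have p: "(\<lambda>z. \<Sum>n<N. b n * z ^ n) \<in> L2" for N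
    using trig_sum_L2[of b int "{..<N}"] by simp
  have "(\<lambda>N. L2_inner (\<lambda>z. \<Sum>n<N. b n * z ^ n) (\<lambda>z. z powi m)) \<longlonglongrightarrow> L2_inner g (\<lambda>z. z powi m)"
    by (rule tendsto_L2_inner) (use g b p L2_powi in auto)
  moreover have "L2_inner (\<lambda>z. \<Sum>n<N. b n * z ^ n) (\<lambda>z. z powi m) = (if 0 \<le> m then b (nat m) else 0)"
    if "nat m < N" for N
  proof -
    have "L2_inner (\<lambda>z. \<Sum>n<N. b n * z powi int n) (\<lambda>z. z powi m)
       = (\<Sum>n<N. b n * L2_inner (\<lambda>z. z powi int n) (\<lambda>z. z powi m))"
      by (subst L2_inner_sum_left) (auto simp only: L2_inner_cmult_left intro: L2_cmult L2_powi)
    also have "\<dots> = (\<Sum>n<N. if n = nat m then (if 0 \<le> m then b n else 0) else 0)"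
      unfolding L2_inner_powi by (intro sum.cong refl) auto
    finally show ?thesis using that by simp
  qed
  then have "(\<lambda>N. L2_inner (\<lambda>z. \<Sum>n<N. b n * z ^ n) (\<lambda>z. z powi m)) \<longlonglongrightarrow> (if 0 \<le> m then b (nat m) else 0)"
    by (intro tendsto_eventually eventually_sequentiallyI[of "Suc (nat m)"]) auto
  ultimately show ?thesis
    unfolding fourier_coeff_eq_L2_inner by (rule LIMSEQ_unique)
qed

lemma H2_0_fourier_coeff:
  assumes "g \<in> H2_0" "m \<le> 0"
  shows "fourier_coeff g m = 0"
proof (cases "m = 0")
  case False
  obtain b where "g \<in> L2" "(\<lambda>N. L2_norm (\<lambda>z. g z - (\<Sum>n<N. b n * z ^ n))) \<longlonglongrightarrow> 0"
    using assms(1) by (auto simp: H2_0_def H2_def)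
  from H2_fourier_coeff[OF this, of m] show ?thesis using False assms(2) by simp
qed (use assms in \<open>simp add: H2_0_def\<close>)

lemma trig_series_H2_minus:
  assumes "summable (\<lambda>n. cmod (a n))"
  shows "trig_series (\<lambda>n. - int n) a \<in> H2_minus"
  unfolding H2_minus_def
proof (intro CollectI conjI ballI trig_series_L2 assms)
  fix g assume g: "g \<in> H2_0"
  then have "g \<in> L2" by (simp add: H2_0_def H2_def)
  have "L2_inner (\<lambda>z. z powi - int n) g = 0" for n
    using H2_0_fourier_coeff[OF g, of "- int n"]
    by (subst L2_inner_cnj) (simp add: fourier_coeff_eq_L2_inner)
  with L2_inner_trig_series[OF assms \<open>g \<in> L2\<close>, of "\<lambda>n. - int n"]
  show "L2_inner (trig_series (\<lambda>n. - int n) a) g = 0" by (simp add: sums_iff)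
qed

lemma trig_series_H2_0:
  assumes "summable (\<lambda>n. cmod (a n))"
  shows "trig_series (\<lambda>n. int n + 1) a \<in> H2_0"
proof -
  let ?s = "\<lambda>n. int n + 1"
  define b where "b n = (case n of 0 \<Rightarrow> 0 | Suc m \<Rightarrow> a m)" for n
  have "(\<lambda>n. cmod (a n)) \<longlonglongrightarrow> 0" by (rule summable_LIMSEQ_zero[OF assms])
  then have "eventually (\<lambda>n. cmod (a n) < 1) sequentially" by (rule order_tendstoD) simp
  then have "eventually (\<lambda>n. norm ((cmod (a n))\<^sup>2) \<le> cmod (a n)) sequentially"
    by eventually_elim (simp add: power2_eq_square mult_left_le)
  then have "summable (\<lambda>n. (cmod (a n))\<^sup>2)" by (rule summable_comparison_test_ev[OF _ assms])
  then have "summable (\<lambda>n. (cmod (b (Suc n)))\<^sup>2)" by (simp add: b_def)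
  then have 1: "summable (\<lambda>n. (cmod (b n))\<^sup>2)" by (subst (asm) summable_Suc_iff)
  have "(\<Sum>n<Suc N. b n * z ^ n) = (\<Sum>n<N. a n * z powi ?s n)" for N z
    by (subst sum.lessThan_Suc_shift) (simp add: b_def power_int_def nat_add_distrib)
  then have "(\<lambda>N. L2_norm (\<lambda>z. trig_series ?s a z - (\<Sum>n<Suc N. b n * z ^ n))) \<longlonglongrightarrow> 0"
    using trig_series_L2_tendsto[OF assms, of ?s] by simp
  then have 2: "(\<lambda>N. L2_norm (\<lambda>z. trig_series ?s a z - (\<Sum>n<N. b n * z ^ n))) \<longlonglongrightarrow> 0"
    by (subst (asm) filterlim_sequentially_Suc)
  have 3: "fourier_coeff (trig_series ?s a) 0 = 0"
    using fourier_coeff_trig_series[OF assms, of ?s 0] by (simp add: sums_iff)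
  show ?thesis unfolding H2_0_def H2_def using 1 2 3 trig_series_L2[OF assms] by auto
qed

text \<open>
  Two functions with the defining property of the projection differ by a function in \<open>V\<close> that is
  orthogonal to itself. One such function \<open>h\<close> guarantees that the choice operator returns one.
\<close>

lemma orth_proj_unique:
  assumes V: "V \<subseteq> L2" "\<And>h h'. h \<in> V \<Longrightarrow> h' \<in> V \<Longrightarrow> (\<lambda>z. h z - h' z) \<in> V"
    and g: "g \<in> L2" and h: "h \<in> V" "\<And>k. k \<in> V \<Longrightarrow> L2_inner (\<lambda>z. g z - h z) k = 0"
  shows "orth_proj V g \<in> V" "AE z in circle. orth_proj V g z = h z"
proof -
  define p where "p = orth_proj V g"
  have "p \<in> V \<and> (\<forall>k\<in>V. L2_inner (\<lambda>z. g z - p z) k = 0)"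
    unfolding p_def orth_proj_def by (rule someI[of _ h]) (use h in blast)
  then have p: "p \<in> V" "\<And>k. k \<in> V \<Longrightarrow> L2_inner (\<lambda>z. g z - p z) k = 0" by blast+
  let ?d = "\<lambda>z. p z - h z"
  have d: "?d \<in> V" by (rule V(2)[OF p(1) h(1)])
  have L: "p \<in> L2" "h \<in> L2" "?d \<in> L2" using V(1) p(1) h(1) d by auto
  have "L2_inner ?d ?d = L2_inner (\<lambda>z. (g z - h z) - (g z - p z)) ?d" by simp
  also have "\<dots> = 0"
    using p(2)[OF d] h(2)[OF d] by (subst L2_inner_diff_left) (auto intro: L2_diff g L)
  finally have "(LINT z|circle. of_real ((cmod (?d z))\<^sup>2)) = (0::complex)"
    by (simp only: L2_inner_def complex_norm_square)
  then have "(LINT z|circle. (cmod (?d z))\<^sup>2) = 0" by (simp only: integral_complex_of_real of_real_eq_0_iff)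
  then have "AE z in circle. (cmod (?d z))\<^sup>2 = 0"
    using L(3) by (subst (asm) integral_nonneg_eq_0_iff_AE) (auto simp: L2_def)
  then show "AE z in circle. orth_proj V g z = h z" by (simp add: p_def)
  show "orth_proj V g \<in> V" using p(1) by (simp add: p_def)
qed

lemma R_minus_unique:
  assumes "g \<in> L2" "h \<in> H2_minus" "\<And>k. k \<in> H2_minus \<Longrightarrow> L2_inner (\<lambda>z. g z - h z) k = 0"
  shows "R_minus g \<in> H2_minus" "AE z in circle. R_minus g z = h z"
proof -
  have V: "H2_minus \<subseteq> L2" by (auto simp: H2_minus_def)
  have D: "(\<lambda>z. h z - h' z) \<in> H2_minus" if "h \<in> H2_minus" "h' \<in> H2_minus" for h h'
    using that by (auto simp: H2_minus_def L2_inner_diff_left H2_0_def H2_def intro: L2_diff)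
  show "R_minus g \<in> H2_minus" "AE z in circle. R_minus g z = h z"
    unfolding R_minus_def by (rule orth_proj_unique[OF V D assms]; assumption)+
qed

section \<open>Hankel operators with a hyper-positive symbol\<close>

text \<open>
  The averages of the first \<open>N\<close> terms are nonnegative and converge to the same limit. This is the form
  in which Cesaro summation enters.
\<close>

lemma limit_nonneg_if_partial_sums_nonneg:
  fixes x :: "nat \<Rightarrow> real"
  assumes "x \<longlonglongrightarrow> L" "\<And>N. 0 \<le> (\<Sum>j<N. x j)"
  shows "0 \<le> L"
proof (rule ccontr)
  assume "\<not> 0 \<le> L"
  then have "L < L / 2" "L / 2 < 0" by simp_all
  then obtain m where m: "x j < L / 2" if "m \<le> j" for j
    using order_tendstoD(2)[OF assms(1), of "L / 2"] by (auto simp: eventually_sequentially)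
  have le: "(\<Sum>j<m + n. x j) \<le> (\<Sum>j<m. x j) + real n * (L / 2)" for n
  proof (induction n)
    case (Suc n)
    then show ?case using m[of "m + n"] by (simp add: algebra_simps add_divide_distrib)
  qed simp
  obtain n where "(\<Sum>j<m. x j) < real n * (- (L / 2))"
    using ex_less_of_nat_mult[of "- (L / 2)"] \<open>L / 2 < 0\<close> by auto
  then show False using le[of n] assms(2)[of "m + n"] by simp
qed

text \<open>
  A hyper-positive function enters the argument through its Fourier coefficients \<open>c\<close>. The first
  condition expresses that the function is real-valued.
\<close>

locale hyper_positive_symbol =
  fixes c :: "int \<Rightarrow> complex"
  assumes hermitian: "\<And>n. c (- n) = cnj (c n)"
    and hyper_pd: "hyper_positive_definite 2 (\<lambda>n. c (int n))"
begin

definition "ratio = 1 / sqrt 2"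

lemma ratio: "0 < ratio" "ratio < 1"
  by (simp_all add: ratio_def)

lemma decay: "cmod (c n) \<le> \<bar>Re (c 0)\<bar> * ratio ^ nat \<bar>n\<bar>"
proof -
  have *: "cmod (c (int m)) \<le> \<bar>Re (c 0)\<bar> * ratio ^ m" for m
  proof (rule power2_le_imp_le)
    have "(ratio ^ m)\<^sup>2 = 1 / 2 ^ m"
      unfolding power_even_eq[symmetric] power_mult
      by (simp add: ratio_def power_divide)
    with hyper_positive_definite_decay[of c 2, OF hermitian hyper_pd, of m]
    have "(cmod (c (int m)))\<^sup>2 \<le> (Re (c 0))\<^sup>2 * (ratio ^ m)\<^sup>2"
      by (simp only: \<open>(ratio ^ m)\<^sup>2 = 1 / 2 ^ m\<close>) (simp add: field_simps)
    then show "(cmod (c (int m)))\<^sup>2 \<le> (\<bar>Re (c 0)\<bar> * ratio ^ m)\<^sup>2"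
      by (simp add: power_mult_distrib)
  qed (use ratio in simp)
  show ?thesis
  proof (cases "0 \<le> n")
    case True
    then show ?thesis using *[of "nat n"] by simp
  next
    case False
    then show ?thesis using *[of "nat (- n)"] hermitian[of n] by simp
  qed
qed

lemma summable_shift:
  "summable (\<lambda>n. cmod (c (int n + k)))" "summable (\<lambda>n. cmod (c (- int n + k)))"
proof -
  have *: "summable (\<lambda>n. cmod (c (int n + k)))" for k
  proof (rule geometric_coeffs_summable[OF _ ratio])
    fix n
    let ?m = "nat \<bar>int n + k\<bar>"
    have "ratio ^ (?m + nat \<bar>k\<bar>) \<le> ratio ^ n"
      using ratio by (intro power_decreasing) auto
    then have "ratio ^ ?m \<le> ratio ^ n / ratio ^ nat \<bar>k\<bar>"
      using ratio by (simp add: power_add field_simps)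
    then have "\<bar>Re (c 0)\<bar> * ratio ^ ?m \<le> \<bar>Re (c 0)\<bar> * (ratio ^ n / ratio ^ nat \<bar>k\<bar>)"
      by (intro mult_left_mono) auto
    then show "cmod (c (int n + k)) \<le> (\<bar>Re (c 0)\<bar> / ratio ^ nat \<bar>k\<bar>) * ratio ^ n"
      using decay[of "int n + k"] by simp
  qed
  show "summable (\<lambda>n. cmod (c (int n + k)))" by (rule *)
  have "cmod (c (- int n + k)) = cmod (c (int n + (- k)))" for n
    using hermitian[of "int n + (- k)"] by (simp add: add.commute)
  then show "summable (\<lambda>n. cmod (c (- int n + k)))" using *[of "- k"] by simp
qed

text \<open>
  The sum of the Fourier series with coefficients \<open>c\<close>, written as twice the real part of its analytic
  half so that it is real by construction.
\<close>

definition symbol :: "complex \<Rightarrow> real" where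
  "symbol z = 2 * Re (trig_series int (\<lambda>n. c (int n)) z) - Re (c 0)"

text \<open>
  The Fourier series of \<open>symbol z * z ^ k\<close>, split into its modes at least \<open>1\<close> and its modes at most \<open>0\<close>.
  Multiplication by \<open>z\<close> shifts all modes up by one and so carries just the mode \<open>0\<close> from the second series
  to the first; this is the induction step.
\<close>

lemma symbol_mult_power:
  assumes z: "cmod z = 1"
  shows "of_real (symbol z) * z ^ k =
    trig_series (\<lambda>n. int n + 1) (\<lambda>n. c (int n + (1 - int k))) z +
    trig_series (\<lambda>n. - int n) (\<lambda>n. c (- int n + (- int k))) z"
proof (induction k)
  case 0
  let ?G = "trig_series int (\<lambda>n. c (int n)) z"
  have S: "(\<lambda>n. c (int n) * z powi int n) sums ?G"
    unfolding trig_series_def using trig_series_summable[OF summable_shift(1)[of 0] z, of int]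
    by (simp add: summable_sums)
  have "trig_series (\<lambda>n. int n + 1) (\<lambda>n. c (int n + 1)) z = ?G - c 0"
    using S sums_split_initial_segment[OF S, of 1]
    by (simp add: trig_series_def sums_iff add.commute)
  moreover have "trig_series (\<lambda>n. - int n) (\<lambda>n. c (- int n)) z = cnj ?G"
  proof -
    have "z * cnj z = 1" using z by (simp add: complex_norm_square[symmetric])
    then have "inverse z = cnj z" by (rule inverse_unique)
    then have "cnj (c (int n) * z powi int n) = c (- int n) * z powi - int n" for n
      by (simp add: hermitian power_int_minus power_inverse[symmetric])
    moreover have "(\<lambda>n. cnj (c (int n) * z powi int n)) sums cnj ?G"
      using S by (simp only: sums_cnj)
    ultimately show ?thesis by (simp add: trig_series_def sums_iff)
  qed
  moreover have "of_real (Re (c 0)) = c 0"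
    using hermitian[of 0] by (simp add: complex_eq_iff)
  then have "complex_of_real (symbol z) = ?G + cnj ?G - c 0"
    by (simp add: symbol_def complex_eq_iff)
  ultimately show ?case by simp
next
  case (Suc k)
  have z0: "z \<noteq> 0" using z by auto
  let ?a = "\<lambda>n. c (int n + (1 - int k)) * z powi (int n + 1)"
  let ?b = "\<lambda>n. c (- int n + (- int k)) * z powi - int n"
  let ?a' = "\<lambda>n. c (int n + (1 - int (Suc k))) * z powi (int n + 1)"
  let ?b' = "\<lambda>n. c (- int n + (- int (Suc k))) * z powi - int n"
  have s: "summable ?a" "summable ?b" "summable ?a'" "summable ?b'"
    by (intro trig_series_summable summable_shift z)+
  have "z * ?a n = ?a' (Suc n)" "z * ?b (Suc n) = ?b' n" for n
  proof -
    have p: "z * z powi m = z powi (m + 1)" for m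
      using z0 by (simp add: power_int_add)
    have a: "z powi (int (Suc n) + 1) = z * z powi (int n + 1)"
        "int (Suc n) + (1 - int (Suc k)) = int n + (1 - int k)"
      using p[of "int n + 1"] by (simp_all add: add.commute)
    show "z * ?a n = ?a' (Suc n)" unfolding a by (rule mult.left_commute)
    have b: "z powi - int n = z * z powi - int (Suc n)"
        "- int n + - int (Suc k) = - int (Suc n) + - int k"
      using p[of "- int (Suc n)"] by simp_all
    show "z * ?b (Suc n) = ?b' n" unfolding b by (rule mult.left_commute)
  qed
  then have "(\<Sum>n. ?a' (Suc n)) = z * suminf ?a" "suminf ?b' = (\<Sum>n. z * ?b (Suc n))"
    using suminf_mult[OF s(1), of z] by simp_all
  then have A: "suminf ?a' = z * suminf ?a + ?a' 0"
    using suminf_split_head[OF s(3)] by (simp only: diff_eq_eq)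
  have "summable (\<lambda>n. ?b (Suc n))" using s(2) by (rule summable_Suc_iff[of ?b, THEN iffD2])
  then have "(\<Sum>n. z * ?b (Suc n)) = z * (suminf ?b - ?b 0)"
    by (subst suminf_split_head[OF s(2), symmetric]) (rule suminf_mult)
  then have B: "suminf ?b' = z * suminf ?b - z * ?b 0"
    using \<open>suminf ?b' = (\<Sum>n. z * ?b (Suc n))\<close> by (simp only: right_diff_distrib)
  \<comment> \<open>The mode \<open>0\<close> of the second series becomes the mode \<open>1\<close> of the first.\<close>
  have "?a' 0 = z * ?b 0" by simp
  then have "suminf ?a' + suminf ?b' = z * (suminf ?a + suminf ?b)"
    unfolding A B by (simp only: distrib_left) simp
  then show ?case using Suc.IH by (simp add: trig_series_def mult.left_commute)
qed

lemma symbol_measurable [measurable]: "symbol \<in> borel_measurable circle"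
  unfolding symbol_def[abs_def] by measurable

lemma symbol_bounded: "\<exists>B>0. \<forall>z. cmod z = 1 \<longrightarrow> \<bar>symbol z\<bar> \<le> B"
proof (intro exI conjI allI impI)
  let ?S = "\<Sum>n. cmod (c (int n))"
  have s: "summable (\<lambda>n. cmod (c (int n)))" using summable_shift(1)[of 0] by simp
  show "0 < 2 * ?S + \<bar>Re (c 0)\<bar> + 1" using suminf_nonneg[OF s] by simp
  fix z :: complex assume z: "cmod z = 1"
  have "cmod (trig_series int (\<lambda>n. c (int n)) z) \<le> ?S"
    using trig_series_tail[OF s z, of int 0] by simp
  then show "\<bar>symbol z\<bar> \<le> 2 * ?S + \<bar>Re (c 0)\<bar> + 1"
    using abs_Re_le_cmod[of "trig_series int (\<lambda>n. c (int n)) z"] by (simp add: symbol_def)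
qed

lemma L2_symbol_mult: "f \<in> L2 \<Longrightarrow> (\<lambda>z. of_real (symbol z) * f z) \<in> L2"
proof -
  assume f: "f \<in> L2"
  obtain B where "\<forall>z. cmod z = 1 \<longrightarrow> \<bar>symbol z\<bar> \<le> B" using symbol_bounded by blast
  then show ?thesis by (intro L2_mult_bounded(1)[OF f, of _ B]) auto
qed

abbreviation "pos_modes k \<equiv> trig_series (\<lambda>n. int n + 1) (\<lambda>n. c (int n + (1 - int k)))"
abbreviation "neg_modes k \<equiv> trig_series (\<lambda>n. - int n) (\<lambda>n. c (- int n + (- int k)))"

lemma fourier_coeff_symbol_mult_power:
  "fourier_coeff (\<lambda>z. of_real (symbol z) * z ^ k) m = c (m - int k)"
proof -
  have "fourier_coeff (\<lambda>z. of_real (symbol z) * z ^ k) m = L2_inner (\<lambda>z. pos_modes k z + neg_modes k z) (\<lambda>z. z powi m)"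
    unfolding fourier_coeff_eq_L2_inner by (rule L2_inner_cong) (simp_all add: symbol_mult_power)
  also have "\<dots> = fourier_coeff (pos_modes k) m + fourier_coeff (neg_modes k) m"
    unfolding fourier_coeff_eq_L2_inner
    by (rule L2_inner_add_left) (intro trig_series_L2 summable_shift L2_powi)+
  also have "\<dots> = c (m - int k)"
  proof (cases "1 \<le> m")
    case True
    then obtain i where "m = int i + 1" using zero_le_imp_eq_int[of "m - 1"] by (auto simp: algebra_simps)
    then have "fourier_coeff (pos_modes k) m = c (m - int k)"
      using fourier_coeff_trig_series_range[OF summable_shift(1), of "\<lambda>n. int n + 1" "1 - int k" i]
      by (simp add: inj_def algebra_simps)
    moreover have "fourier_coeff (neg_modes k) m = 0"
      by (rule fourier_coeff_trig_series_outside[OF summable_shift(2)]) (use True in auto)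
    ultimately show ?thesis by simp
  next
    case False
    then have "0 \<le> - m" by simp
    then obtain i where "- m = int i" using zero_le_imp_eq_int by blast
    then have "m = - int i" by simp
    then have "fourier_coeff (neg_modes k) m = c (m - int k)"
      using fourier_coeff_trig_series_range[OF summable_shift(2), of "\<lambda>n. - int n" "- int k" i]
      by (simp add: inj_def)
    moreover have "fourier_coeff (pos_modes k) m = 0"
      by (rule fourier_coeff_trig_series_outside[OF summable_shift(1)]) (use False in auto)
    ultimately show ?thesis by simp
  qed
  finally show ?thesis .
qed

definition hankel_coeff :: "(nat \<Rightarrow> complex) \<Rightarrow> nat set \<Rightarrow> nat \<Rightarrow> complex" where
  "hankel_coeff a Q l = (\<Sum>k\<in>Q. a k * c (- int l + (- int k)))"

text \<open>
  The image of the polynomial \<open>(\<Sum>k\<in>Q. a k * z ^ k)\<close> under the Hankel operator, given by its Fourier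
  series.
\<close>

definition hankel_poly :: "(nat \<Rightarrow> complex) \<Rightarrow> nat set \<Rightarrow> complex \<Rightarrow> complex" where
  "hankel_poly a Q = trig_series (\<lambda>n. - int n) (hankel_coeff a Q)"

lemma hankel_coeff_summable: "summable (\<lambda>l. cmod (hankel_coeff a Q l))"
proof (rule summable_comparison_test')
  show "summable (\<lambda>l. \<Sum>k\<in>Q. cmod (a k) * cmod (c (- int l + (- int k))))"
    by (intro summable_sum summable_mult summable_shift)
  show "norm (cmod (hankel_coeff a Q l)) \<le> (\<Sum>k\<in>Q. cmod (a k) * cmod (c (- int l + (- int k))))" for l
    unfolding hankel_coeff_def using norm_sum[of "\<lambda>k. a k * c (- int l + (- int k))" Q] by (simp add: norm_mult)
qed

lemma hankel_poly_L2: "hankel_poly a Q \<in> L2"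
  unfolding hankel_poly_def by (intro trig_series_L2 hankel_coeff_summable)

lemma poly_L2: "(\<lambda>z. \<Sum>k\<in>Q. a k * z ^ k) \<in> L2"
  using trig_sum_L2[of a int Q] by simp

text \<open>
  The difference consists of the modes at least \<open>1\<close> of the product and hence lies in \<open>H2_0\<close>.
\<close>

lemma hankel_poly_orthogonal:
  assumes k': "k' \<in> H2_minus"
  shows "L2_inner (\<lambda>z. of_real (symbol z) * (\<Sum>k\<in>Q. a k * z ^ k) - hankel_poly a Q z) k' = 0"
proof -
  have k'': "k' \<in> L2" using k' by (simp add: H2_minus_def)
  have "L2_inner (\<lambda>z. of_real (symbol z) * (\<Sum>k\<in>Q. a k * z ^ k) - hankel_poly a Q z) k'
     = L2_inner (\<lambda>z. \<Sum>k\<in>Q. a k * pos_modes k z) k'"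
  proof (rule L2_inner_cong)
    fix z :: complex assume z: "cmod z = 1"
    have "hankel_poly a Q z = (\<Sum>k\<in>Q. a k * neg_modes k z)"
      unfolding hankel_poly_def hankel_coeff_def[abs_def]
      by (rule trig_series_sum[OF summable_shift(2) z])
    moreover have "of_real (symbol z) * (\<Sum>k\<in>Q. a k * z ^ k) = (\<Sum>k\<in>Q. a k * (of_real (symbol z) * z ^ k))"
      by (simp add: sum_distrib_left mult.left_commute)
    ultimately show "of_real (symbol z) * (\<Sum>k\<in>Q. a k * z ^ k) - hankel_poly a Q z = (\<Sum>k\<in>Q. a k * pos_modes k z)"
      unfolding symbol_mult_power[OF z] by (simp add: distrib_left sum.distrib)
  qed simp
  also have "\<dots> = (\<Sum>k\<in>Q. a k * L2_inner (pos_modes k) k')"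
    by (subst L2_inner_sum_left) (auto simp: L2_inner_cmult_left intro!: L2_cmult trig_series_L2 summable_shift k'')
  also have "\<dots> = 0"
  proof (intro sum.neutral ballI)
    fix k
    have "L2_inner k' (pos_modes k) = 0"
      using k' trig_series_H2_0[OF summable_shift(1)[of "1 - int k"]] by (simp add: H2_minus_def L2_inner_cnj[of _ k'])
    then show "a k * L2_inner (pos_modes k) k' = 0" by (subst L2_inner_cnj) simp
  qed
  finally show ?thesis .
qed

lemma weighted_norm_poly:
  "L2_inner (\<lambda>z. of_real (symbol z) * (\<Sum>k\<in>Q. a k * z ^ k)) (\<lambda>z. \<Sum>k\<in>Q. a k * z ^ k) =
    (\<Sum>k\<in>Q. \<Sum>k'\<in>Q. a k * c (int k' - int k) * cnj (a k'))"
proof -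
  have d: "(\<lambda>z. of_real (symbol z) * z ^ k) \<in> L2" for k
    using L2_symbol_mult[OF L2_powi[of "int k"]] by simp
  have "L2_inner (\<lambda>z. of_real (symbol z) * (\<Sum>k\<in>Q. a k * z ^ k)) (\<lambda>z. \<Sum>k\<in>Q. a k * z ^ k) =
     L2_inner (\<lambda>z. \<Sum>k\<in>Q. a k * (of_real (symbol z) * z ^ k)) (\<lambda>z. \<Sum>k\<in>Q. a k * z ^ k)"
    by (simp add: sum_distrib_left mult.left_commute)
  also have "\<dots> = (\<Sum>k\<in>Q. a k * L2_inner (\<lambda>z. of_real (symbol z) * z ^ k) (\<lambda>z. \<Sum>k\<in>Q. a k * z ^ k))"
    by (subst L2_inner_sum_left) (auto simp: L2_inner_cmult_left intro: L2_cmult d poly_L2)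
  also have "\<dots> = (\<Sum>k\<in>Q. a k * (\<Sum>k'\<in>Q. cnj (a k') * L2_inner (\<lambda>z. of_real (symbol z) * z ^ k) (\<lambda>z. z ^ k')))"
  proof (intro sum.cong refl arg_cong[where f = "(*) _"])
    fix k
    have "L2_inner (\<lambda>z. of_real (symbol z) * z ^ k) (\<lambda>z. \<Sum>k'\<in>Q. a k' * z ^ k')
       = (\<Sum>k'\<in>Q. L2_inner (\<lambda>z. of_real (symbol z) * z ^ k) (\<lambda>z. a k' * z ^ k'))"
      by (rule L2_inner_sum_right) (use L2_cmult[OF L2_powi[of "int _"]] d in auto)
    then show "L2_inner (\<lambda>z. of_real (symbol z) * z ^ k) (\<lambda>z. \<Sum>k'\<in>Q. a k' * z ^ k')
       = (\<Sum>k'\<in>Q. cnj (a k') * L2_inner (\<lambda>z. of_real (symbol z) * z ^ k) (\<lambda>z. z ^ k'))"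
      by (simp add: L2_inner_cmult_right)
  qed
  also have "\<dots> = (\<Sum>k\<in>Q. a k * (\<Sum>k'\<in>Q. cnj (a k') * c (int k' - int k)))"
    using fourier_coeff_symbol_mult_power[of _ "int _"] by (simp add: fourier_coeff_eq_L2_inner)
  finally show ?thesis by (simp add: sum_distrib_left mult_ac)
qed

text \<open>
  The inequality \<open>hyper_positive_definite_Bessel\<close> after Cesaro summation: its two sides are sums of
  sequences converging to the two sides here.
\<close>

lemma hankel_poly_bound:
  assumes z: "cmod z = 1" and Q: "finite Q" "0 \<notin> Q"
  shows "(cmod (hankel_poly a Q z))\<^sup>2 \<le>
    Re (L2_inner (\<lambda>z. of_real (symbol z) * (\<Sum>k\<in>Q. a k * z ^ k)) (\<lambda>z. \<Sum>k\<in>Q. a k * z ^ k)) * symbol z"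
    (is "_ \<le> ?A * _")
proof -
  let ?h = "hankel_coeff a Q"
  define S where "S j = (\<Sum>l\<le>j. ?h l * cnj z ^ l)" for j
  define D where "D j = Re (c 0) + 2 * Re (\<Sum>d=1..j. c (int d) * z ^ d)" for j
  have "z * cnj z = 1" using z by (simp add: complex_norm_square[symmetric])
  then have inv: "inverse z = cnj z" by (rule inverse_unique)
  have S: "S \<longlonglongrightarrow> hankel_poly a Q z"
  proof -
    have "(\<lambda>l. ?h l * z powi - int l) sums hankel_poly a Q z"
      unfolding hankel_poly_def trig_series_def
      using trig_series_summable[OF hankel_coeff_summable z] by (rule summable_sums)
    then show ?thesis unfolding S_def sums_def_le by (simp add: power_int_minus inv flip: power_inverse)
  qed
  have D: "D \<longlonglongrightarrow> symbol z"
  proof -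
    have "(\<lambda>d. c (int d) * z powi int d) sums trig_series int (\<lambda>n. c (int n)) z"
      unfolding trig_series_def
      using trig_series_summable[OF summable_shift(1)[of 0] z, of int] by (simp add: summable_sums)
    then have "(\<lambda>j. \<Sum>d\<le>j. c (int d) * z ^ d) \<longlonglongrightarrow> trig_series int (\<lambda>n. c (int n)) z"
      by (simp add: sums_def_le)
    then have "(\<lambda>j. 2 * Re (\<Sum>d\<le>j. c (int d) * z ^ d) - Re (c 0)) \<longlonglongrightarrow> symbol z"
      unfolding symbol_def by (intro tendsto_intros)
    moreover have "2 * Re (\<Sum>d\<le>j. c (int d) * z ^ d) - Re (c 0) = D j" for j
    proof -
      have "{..j} = insert 0 {1..j}" by auto
      then have "(\<Sum>d\<le>j. c (int d) * z ^ d) = c 0 + (\<Sum>d=1..j. c (int d) * z ^ d)" by simp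
      then show ?thesis unfolding D_def by simp
    qed
    ultimately show ?thesis by (simp only:)
  qed
  have "0 \<le> ?A * symbol z - (cmod (hankel_poly a Q z))\<^sup>2"
  proof (rule limit_nonneg_if_partial_sums_nonneg)
    show "(\<lambda>j. ?A * D j - (cmod (S j))\<^sup>2) \<longlonglongrightarrow> ?A * symbol z - (cmod (hankel_poly a Q z))\<^sup>2"
      by (intro tendsto_intros S D)
    have "?h = (\<lambda>l. \<Sum>k\<in>Q. a k * c (- int (l + k)))"
      by (simp add: hankel_coeff_def[abs_def])
    then have "(\<Sum>j<N. (cmod (S j))\<^sup>2) \<le> ?A * (\<Sum>j<N. D j)" for N
      unfolding S_def D_def weighted_norm_poly
      using hyper_positive_definite_Bessel[of c, OF hermitian hyper_pd z Q, of a N] by simp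
    then show "0 \<le> (\<Sum>j<N. ?A * D j - (cmod (S j))\<^sup>2)" for N
      by (simp add: sum_subtractf sum_distrib_left)
  qed
  then show ?thesis by simp
qed

text \<open>
  The series constructed here will turn out to be the image of \<open>f\<close> under the Hankel operator. The bound
  and the orthogonality are inherited from the Taylor polynomials of \<open>f\<close>. The Taylor coefficients are bounded and
  \<open>c\<close> decays geometrically, so the images of the polynomials converge uniformly on the circle, while the
  polynomials themselves converge to \<open>f\<close> in \<open>L2\<close> and also in the weighted norm because the symbol is
  bounded.
\<close>

lemma hankel_series:
  assumes f: "f \<in> H2_0"
  obtains b M where "\<And>l. cmod (b l) \<le> M * ratio ^ l"
    and "\<And>z. cmod z = 1 \<Longrightarrow> (cmod (trig_series (\<lambda>n. - int n) b z))\<^sup>2 \<le>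
      Re (L2_inner (\<lambda>z. of_real (symbol z) * f z) f) * symbol z"
    and "\<And>k. k \<in> H2_minus \<Longrightarrow>
      L2_inner (\<lambda>z. of_real (symbol z) * f z - trig_series (\<lambda>n. - int n) b z) k = 0"
proof -
  obtain a where fL: "f \<in> L2" and a_sum: "summable (\<lambda>n. (cmod (a n))\<^sup>2)"
    and a_lim: "(\<lambda>N. L2_norm (\<lambda>z. f z - (\<Sum>n<N. a n * z ^ n))) \<longlonglongrightarrow> 0"
    using f by (auto simp: H2_0_def H2_def)
  have a0: "a 0 = 0"
    using H2_fourier_coeff[OF fL a_lim, of 0] H2_0_fourier_coeff[OF f, of 0] by simp
  define M where "M = sqrt (\<Sum>n. (cmod (a n))\<^sup>2)"
  have aM: "cmod (a k) \<le> M" for k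
  proof -
    have "(\<Sum>n\<in>{k}. (cmod (a n))\<^sup>2) \<le> (\<Sum>n. (cmod (a n))\<^sup>2)"
      by (rule sum_le_suminf[OF a_sum]) auto
    then show ?thesis unfolding M_def by (intro real_le_rsqrt) simp
  qed
  have M0: "0 \<le> M" using aM[of 0] norm_ge_zero order_trans by blast
  \<comment> \<open>The branches of the tree carry exponents \<open>k \<ge> 1\<close>; the exponent \<open>0\<close> is absent because \<open>f\<close> has mean \<open>0\<close>.\<close>
  let ?Q = "\<lambda>K. {1..<K}"
  define p where "p K z = (\<Sum>k\<in>?Q K. a k * z ^ k)" for K z
  have p: "p K z = (\<Sum>k<K. a k * z ^ k)" for K z
    unfolding p_def using a0 by (intro sum.mono_neutral_left) (auto simp: not_less_eq_eq)
  have p_lim: "(\<lambda>K. L2_norm (\<lambda>z. f z - p K z)) \<longlonglongrightarrow> 0" using a_lim by (simp add: p)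
  have pL: "p K \<in> L2" for K unfolding p_def[abs_def] by (rule poly_L2)
  define C where "C = M * \<bar>Re (c 0)\<bar>"
  have coeff_le: "cmod (a k * c (- int l + (- int k))) \<le> C * ratio ^ l * ratio ^ k" for k l
  proof -
    have "nat \<bar>- int l + (- int k)\<bar> = l + k" by simp
    then have "cmod (c (- int l + (- int k))) \<le> \<bar>Re (c 0)\<bar> * (ratio ^ l * ratio ^ k)"
      using decay[of "- int l + (- int k)"] by (simp only: power_add)
    then have "cmod (a k) * cmod (c (- int l + (- int k))) \<le> M * (\<bar>Re (c 0)\<bar> * (ratio ^ l * ratio ^ k))"
      using aM M0 by (intro mult_mono) auto
    then show ?thesis by (simp add: norm_mult C_def mult.assoc)
  qed
  have geo: "summable (\<lambda>k. D * ratio ^ k)" "(\<Sum>k. D * ratio ^ k) = D / (1 - ratio)" for D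
    using ratio by (simp_all add: summable_mult suminf_mult suminf_geometric)
  have coeff_summable: "summable (\<lambda>k. cmod (a k * c (- int l + (- int k))))" for l
    by (rule summable_comparison_test'[OF geo(1)[of "C * ratio ^ l"]]) (use coeff_le in simp)
  define b where "b l = (\<Sum>k. a k * c (- int l + (- int k)))" for l
  have tail: "cmod (b l - hankel_coeff a (?Q K) l) \<le> (C / (1 - ratio) * ratio ^ K) * ratio ^ l" for l K
  proof -
    let ?t = "\<lambda>k. a k * c (- int l + (- int k))"
    have "hankel_coeff a (?Q K) l = sum ?t {..<K}"
      unfolding hankel_coeff_def using a0 by (intro sum.mono_neutral_left) (auto simp: not_less_eq_eq)
    then have "b l - hankel_coeff a (?Q K) l = (\<Sum>k. ?t (k + K))"
      unfolding b_def using suminf_split_initial_segment[OF summable_norm_cancel[OF coeff_summable[of l]], of K] by simp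
    also have "cmod \<dots> \<le> (\<Sum>k. (C * ratio ^ l * ratio ^ K) * ratio ^ k)"
    proof (rule norm_suminf_le[OF _ geo(1)])
      show "cmod (?t (k + K)) \<le> C * ratio ^ l * ratio ^ K * ratio ^ k" for k
        using coeff_le[of "k + K" l] by (simp add: power_add mult_ac)
    qed
    finally show ?thesis unfolding geo(2) by (simp add: mult_ac)
  qed
  have b_bound: "cmod (b l) \<le> C / (1 - ratio) * ratio ^ l" for l
    using tail[of l 0] by (simp add: hankel_coeff_def)
  have b_sum: "summable (\<lambda>l. cmod (b l))"
    by (rule geometric_coeffs_summable[OF b_bound ratio])
  define F where "F = trig_series (\<lambda>n. - int n) b"
  have FL: "F \<in> L2" unfolding F_def by (rule trig_series_L2[OF b_sum])
  have F_tail: "cmod (F z - hankel_poly a (?Q K) z) \<le> C / (1 - ratio) * ratio ^ K / (1 - ratio)"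
    if z: "cmod z = 1" for K z
  proof -
    have d: "summable (\<lambda>l. cmod (b l - hankel_coeff a (?Q K) l))"
      by (rule geometric_coeffs_summable[OF tail ratio])
    have "F z - hankel_poly a (?Q K) z = trig_series (\<lambda>n. - int n) (\<lambda>l. b l - hankel_coeff a (?Q K) l) z"
      unfolding F_def hankel_poly_def trig_series_def
      using suminf_diff[OF trig_series_summable[OF b_sum z] trig_series_summable[OF hankel_coeff_summable z]]
      by (simp add: left_diff_distrib)
    also have "cmod \<dots> \<le> (\<Sum>l. cmod (b l - hankel_coeff a (?Q K) l))"
      using trig_series_tail[OF d z, of _ 0] by simp
    also have "\<dots> \<le> (\<Sum>l. (C / (1 - ratio) * ratio ^ K) * ratio ^ l)"
      by (rule suminf_le[OF tail d geo(1)])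
    finally show ?thesis unfolding geo(2) .
  qed
  have bound_lim: "(\<lambda>K. C / (1 - ratio) * ratio ^ K / (1 - ratio)) \<longlonglongrightarrow> 0"
    using ratio by (auto intro!: tendsto_eq_intros LIMSEQ_power_zero)
  have F_lim: "(\<lambda>K. hankel_poly a (?Q K) z) \<longlonglongrightarrow> F z" if "cmod z = 1" for z
  proof -
    have "(\<lambda>K. F z - hankel_poly a (?Q K) z) \<longlonglongrightarrow> 0"
      by (rule Lim_null_comparison[OF _ bound_lim]) (use F_tail[OF that] in auto)
    then show ?thesis using tendsto_diff[OF tendsto_const[of "F z"]] by fastforce
  qed
  have F_L2_lim: "(\<lambda>K. L2_norm (\<lambda>z. F z - hankel_poly a (?Q K) z)) \<longlonglongrightarrow> 0"
    by (rule L2_tendsto_if_uniform[OF L2_measurable[OF L2_diff[OF FL hankel_poly_L2]] F_tail bound_lim])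
  have sf_lim: "(\<lambda>K. L2_norm (\<lambda>z. of_real (symbol z) * f z - of_real (symbol z) * p K z)) \<longlonglongrightarrow> 0"
  proof -
    obtain B where B: "\<And>z. cmod z = 1 \<Longrightarrow> \<bar>symbol z\<bar> \<le> B" using symbol_bounded by blast
    have "L2_norm (\<lambda>z. of_real (symbol z) * (f z - p K z)) \<le> B * L2_norm (\<lambda>z. f z - p K z)" for K
      by (rule L2_mult_bounded(2)[OF L2_diff[OF fL pL]]) (use B in auto)
    then show ?thesis
      by (intro Lim_null_comparison[OF _ tendsto_mult_right_zero[OF p_lim, of B]])
        (auto simp: right_diff_distrib L2_norm_nonneg)
  qed
  note spL = L2_symbol_mult[OF pL] and sfL = L2_symbol_mult[OF fL]
  have bound: "(cmod (F z))\<^sup>2 \<le> Re (L2_inner (\<lambda>z. of_real (symbol z) * f z) f) * symbol z" if z: "cmod z = 1" for z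
  proof (rule LIMSEQ_le)
    show "(\<lambda>K. (cmod (hankel_poly a (?Q K) z))\<^sup>2) \<longlonglongrightarrow> (cmod (F z))\<^sup>2"
      by (intro tendsto_intros F_lim z)
    show "(\<lambda>K. Re (L2_inner (\<lambda>z. of_real (symbol z) * p K z) (p K)) * symbol z)
       \<longlonglongrightarrow> Re (L2_inner (\<lambda>z. of_real (symbol z) * f z) f) * symbol z"
      by (intro tendsto_intros tendsto_L2_inner spL sfL pL fL sf_lim p_lim)
    show "\<exists>N. \<forall>K\<ge>N. (cmod (hankel_poly a (?Q K) z))\<^sup>2 \<le> Re (L2_inner (\<lambda>z. of_real (symbol z) * p K z) (p K)) * symbol z"
      unfolding p_def[abs_def] using hankel_poly_bound[OF z, of "?Q _" a] by auto
  qed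
  have orth: "L2_inner (\<lambda>z. of_real (symbol z) * f z - F z) k = 0" if k: "k \<in> H2_minus" for k
  proof -
    have kL: "k \<in> L2" using k by (simp add: H2_minus_def)
    have "(\<lambda>K. L2_inner (\<lambda>z. of_real (symbol z) * p K z) k - L2_inner (hankel_poly a (?Q K)) k)
       \<longlonglongrightarrow> L2_inner (\<lambda>z. of_real (symbol z) * f z) k - L2_inner F k"
      by (intro tendsto_diff tendsto_L2_inner spL sfL kL FL hankel_poly_L2 sf_lim F_L2_lim) simp_all
    moreover have "L2_inner (\<lambda>z. of_real (symbol z) * p K z) k - L2_inner (hankel_poly a (?Q K)) k = 0" for K
      using hankel_poly_orthogonal[OF k, of a "?Q K", folded p_def]
      unfolding L2_inner_diff_left[OF spL hankel_poly_L2 kL] .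
    ultimately have "L2_inner (\<lambda>z. of_real (symbol z) * f z) k - L2_inner F k = 0"
      by (simp add: LIMSEQ_const_iff)
    then show ?thesis by (simp add: L2_inner_diff_left sfL FL kL)
  qed
  show thesis by (rule that[OF b_bound bound[unfolded F_def] orth[unfolded F_def]])
qed

end

section \<open>The bound for Hankel operators\<close>

theorem proposition1p12:
  fixes \<phi> :: "complex \<Rightarrow> real" and f :: "complex \<Rightarrow> complex"
  assumes nonneg: "AE z in circle. 0 \<le> \<phi> z"
    and hyper_pos: "hyper_positive 2 (\<lambda>z. complex_of_real (\<phi> z))"
    and nonzero: "\<not> (AE z in circle. \<phi> z = 0)"
    and hardy: "f \<in> H2_0"
  shows "(\<lambda>z. complex_of_real (\<phi> z) * f z) \<in> L2 \<and>
         AE_real_analytic (hankel (\<lambda>z. complex_of_real (\<phi> z)) f) \<and>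
         Linf_norm (\<lambda>z. hankel (\<lambda>z. complex_of_real (\<phi> z)) f z / complex_of_real (sqrt (\<phi> z)))
           \<le> ereal (weighted_L2_norm \<phi> f)"
proof -
  let ?c = "fourier_coeff (\<lambda>z. complex_of_real (\<phi> z))"
  have int: "integrable circle (\<lambda>z. complex_of_real (\<phi> z))"
    and pd: "hyper_positive_definite 2 (\<lambda>n. ?c (int n))"
    using hyper_pos by (auto simp: hyper_positive_def)
  have meas [measurable]: "\<phi> \<in> borel_measurable circle"
    using borel_measurable_integrable[OF int] by (simp add: borel_measurable_complex_iff)
  have herm: "?c (- n) = cnj (?c n)" for n
  proof -
    have "cnj (?c n) = (LINT z|circle. cnj (complex_of_real (\<phi> z) * z powi (- n)))"
      unfolding fourier_coeff_def by (rule Bochner_Integration.integral_cnj[symmetric])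
    also have "\<dots> = ?c (- n)"
      unfolding fourier_coeff_def
      by (intro Bochner_Integration.integral_cong) (simp_all add: powi_minus_circle)
    finally show ?thesis ..
  qed
  interpret hyper_positive_symbol ?c
    by unfold_locales (use herm pd in auto)
  have eq: "AE z in circle. \<phi> z = symbol z"
  proof -
    obtain B where B: "\<And>z. cmod z = 1 \<Longrightarrow> \<bar>symbol z\<bar> \<le> B" using symbol_bounded by blast
    have int': "integrable circle (\<lambda>z. complex_of_real (symbol z))"
      by (rule integrable_circle_bounded[where B = B]) (use B in auto)
    have "AE z in circle. complex_of_real (\<phi> z) - complex_of_real (symbol z) = 0"
    proof (rule AE_zero_if_fourier_coeff_zero)
      show "integrable circle (\<lambda>z. complex_of_real (\<phi> z) - complex_of_real (symbol z))"
        using int int' by (rule Bochner_Integration.integrable_diff)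
      show "fourier_coeff (\<lambda>z. complex_of_real (\<phi> z) - complex_of_real (symbol z)) n = 0" for n
        unfolding fourier_coeff_diff[OF int int'] using fourier_coeff_symbol_mult_power[of 0 n] by simp
    qed
    then show ?thesis by eventually_elim (simp flip: of_real_diff)
  qed
  have fL: "f \<in> L2" using hardy by (simp add: H2_0_def H2_def)
  have meas_f [measurable]: "f \<in> borel_measurable circle" using fL by (rule L2_measurable)
  have g_eq: "AE z in circle. of_real (symbol z) * f z = of_real (\<phi> z) * f z"
    using eq by eventually_elim simp
  have "integrable circle (\<lambda>z. (cmod (complex_of_real (symbol z) * f z))\<^sup>2)"
    using L2_symbol_mult[OF fL] by (simp add: L2_def)
  then have "integrable circle (\<lambda>z. (cmod (complex_of_real (\<phi> z) * f z))\<^sup>2)"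
    by (rule integrable_cong_AE_imp) (use g_eq in \<open>auto elim!: eventually_mono\<close>)
  then have gL: "(\<lambda>z. complex_of_real (\<phi> z) * f z) \<in> L2"
    by (intro L2_I) measurable
  obtain b M where b: "\<And>l. cmod (b l) \<le> M * ratio ^ l"
    and bound: "\<And>z. cmod z = 1 \<Longrightarrow> (cmod (trig_series (\<lambda>n. - int n) b z))\<^sup>2 \<le>
      Re (L2_inner (\<lambda>z. of_real (symbol z) * f z) f) * symbol z"
    and orth: "\<And>k. k \<in> H2_minus \<Longrightarrow> L2_inner (\<lambda>z. of_real (symbol z) * f z - trig_series (\<lambda>n. - int n) b z) k = 0"
    by (rule hankel_series[OF hardy], rule that)
  let ?F = "trig_series (\<lambda>n. - int n) b" and ?H = "hankel (\<lambda>z. complex_of_real (\<phi> z)) f"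
  have bs: "summable (\<lambda>l. cmod (b l))" by (rule geometric_coeffs_summable[OF b ratio])
  have orth': "L2_inner (\<lambda>z. of_real (\<phi> z) * f z - ?F z) k = 0" if k: "k \<in> H2_minus" for k
  proof -
    have [measurable]: "k \<in> borel_measurable circle" using k by (auto simp: H2_minus_def intro: L2_measurable)
    have "L2_inner (\<lambda>z. of_real (\<phi> z) * f z - ?F z) k = L2_inner (\<lambda>z. of_real (symbol z) * f z - ?F z) k"
      unfolding L2_inner_def by (rule integral_cong_AE) (use g_eq in \<open>measurable, auto elim!: eventually_mono\<close>)
    then show ?thesis using orth[OF k] by simp
  qed
  have H: "?H \<in> H2_minus" "AE z in circle. ?H z = ?F z"
    unfolding hankel_def by (rule R_minus_unique[OF gL trig_series_H2_minus[OF bs] orth']; assumption)+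
  have "AE_real_analytic ?H"
    unfolding AE_real_analytic_def using H(2) real_analytic_trig_series[OF b ratio] by blast
  moreover have "Linf_norm (\<lambda>z. ?H z / complex_of_real (sqrt (\<phi> z))) \<le> ereal (weighted_L2_norm \<phi> f)"
    unfolding Linf_norm_def
  proof (rule esssup_I)
    have [measurable]: "?H \<in> borel_measurable circle"
      using H(1) by (auto simp: H2_minus_def intro: L2_measurable)
    show "(\<lambda>z. ereal (cmod (?H z / complex_of_real (sqrt (\<phi> z))))) \<in> borel_measurable circle"
      by measurable
    have w: "Re (L2_inner (\<lambda>z. of_real (symbol z) * f z) f) = (LINT z|circle. (cmod (f z))\<^sup>2 * \<phi> z)" (is "?A = ?W")
    proof -
      have "L2_inner (\<lambda>z. of_real (symbol z) * f z) f = (LINT z|circle. complex_of_real ((cmod (f z))\<^sup>2 * \<phi> z))"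
        unfolding L2_inner_def
      proof (rule integral_cong_AE)
        show "AE z in circle. of_real (symbol z) * f z * cnj (f z) = complex_of_real ((cmod (f z))\<^sup>2 * \<phi> z)"
          using eq
        proof eventually_elim
          case (elim z)
          show ?case unfolding of_real_mult complex_norm_square elim by (simp only: mult_ac)
        qed
      qed measurable
      then show ?thesis by (simp only: integral_complex_of_real Re_complex_of_real)
    qed
    have W0: "0 \<le> ?W"
      using nonneg by (intro integral_nonneg_AE) (auto elim!: eventually_mono)
    have "AE z in circle. z \<in> space circle" by (rule AE_space)
    then show "AE z in circle. ereal (cmod (?H z / complex_of_real (sqrt (\<phi> z)))) \<le> ereal (weighted_L2_norm \<phi> f)"
      using H(2) eq nonneg
    proof eventually_elim
      case (elim z)
      then have "(cmod (?H z))\<^sup>2 \<le> ?W * \<phi> z" using bound[of z] w by simp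
      then have "cmod (?H z) \<le> sqrt (?W * \<phi> z)" by (rule real_le_rsqrt)
      then have *: "cmod (?H z) \<le> weighted_L2_norm \<phi> f * sqrt (\<phi> z)"
        by (simp add: weighted_L2_norm_def real_sqrt_mult)
      \<comment> \<open>At a zero of \<open>\<phi>\<close> the quotient is \<open>0\<close> because of the convention \<open>x / 0 = 0\<close>.\<close>
      show ?case
      proof (cases "\<phi> z = 0")
        case True
        then show ?thesis using W0 by (simp add: weighted_L2_norm_def)
      next
        case False
        then have "0 < sqrt (\<phi> z)" using elim by simp
        then show ?thesis using * by (simp add: norm_divide divide_le_eq)
      qed
    qed
  qed
  ultimately show ?thesis using gL by blast
qed

end
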